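(* Let $H$ be a non-elementary hyperbolic group with trivial finite radical (this is automatic if $H$ is torsion-free). Then the action ${\rm Aut}(H)\curvearrowright\partial H$ on the Gromov boundary of $H$ is topologically free.
   Context: A finitely generated group $H$ is (Gromov) hyperbolic if its word metric with respect to some finite generating set is Gromov hyperbolic; it is non-elementary if it is infinite and not virtually cyclic. $H$ has trivial finite radical if it has no non-trivial finite normal subgroup. The Gromov boundary $\partial H$ is the set of equivalence classes of geodesic rays, where two rays are identified if they stay a bounded (Hausdorff) distance apart, with its usual compact metrizable topology. A quasi-isometry $\varphi:K\to H$ induces a homeomorphism $\partial\varphi:\partial K\to\partial H$; in particular every automorphism $\varphi\in{\rm Aut}(H)$ is a quasi-isometry of $H$ and the action ${\rm Aut}(H)\curvearrowright\partial H$ is $\varphi\mapsto\partial\varphi$. An action of a countable group $\Gamma$ by homeomorphisms on a compact Hausdorff space $X$ is topologically free if for every $g\in\Gamma\setminus\{1\}$ the fixed-point set $\{x\in X: gx=x\}$ has empty interior (equivalently, for countable $\Gamma$, the set of points with trivial stabilizer is dense in $X$). *)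

theory Defs
  imports
    "HOL-Algebra.Bij"
    "HOL-Algebra.Elementary_Groups"
    "HOL-Analysis.Function_Topology"
begin

section \<open>Word metrics and hyperbolic groups\<close>

definition finite_generating_set :: "('a, 'b) monoid_scheme \<Rightarrow> 'a set \<Rightarrow> bool" where
  "finite_generating_set G S \<longleftrightarrow>
     finite S \<and> S \<subseteq> carrier G \<and> generate G S = carrier G"

text \<open>Words are lists over \<open>S\<close> and its inverses. The length is meaningless (an arbitrary natural
  number) for elements outside the subgroup generated by \<open>S\<close>.\<close>

definition word_length :: "('a, 'b) monoid_scheme \<Rightarrow> 'a set \<Rightarrow> 'a \<Rightarrow> nat" where
  "word_length G S g =
     (LEAST n. \<exists>ws. length ws = n \<and> set ws \<subseteq> S \<union> m_inv G ` S \<and>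
                    foldr (mult G) ws (one G) = g)"

definition word_dist :: "('a, 'b) monoid_scheme \<Rightarrow> 'a set \<Rightarrow> 'a \<Rightarrow> 'a \<Rightarrow> real" where
  "word_dist G S x y = real (word_length G S (mult G (m_inv G x) y))"

definition Gromov_product :: "('a \<Rightarrow> 'a \<Rightarrow> real) \<Rightarrow> 'a \<Rightarrow> 'a \<Rightarrow> 'a \<Rightarrow> real" where
  "Gromov_product d w x y = (d w x + d w y - d x y) / 2"

definition Gromov_hyperbolic :: "'a set \<Rightarrow> ('a \<Rightarrow> 'a \<Rightarrow> real) \<Rightarrow> bool" where
  "Gromov_hyperbolic M d \<longleftrightarrow>
     (\<exists>\<delta>. \<forall>w\<in>M. \<forall>x\<in>M. \<forall>y\<in>M. \<forall>z\<in>M.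
        Gromov_product d w x z \<ge> min (Gromov_product d w x y) (Gromov_product d w y z) - \<delta>)"

definition hyperbolic_group :: "('a, 'b) monoid_scheme \<Rightarrow> bool" where
  "hyperbolic_group G \<longleftrightarrow>
     (\<exists>S. finite_generating_set G S \<and> Gromov_hyperbolic (carrier G) (word_dist G S))"

definition virtually_cyclic :: "('a, 'b) monoid_scheme \<Rightarrow> bool" where
  "virtually_cyclic G \<longleftrightarrow>
     (\<exists>K. subgroup K G \<and> cyclic_group (subgroup_generated G K) \<and> finite (rcosets\<^bsub>G\<^esub> K))"

definition non_elementary :: "('a, 'b) monoid_scheme \<Rightarrow> bool" where
  "non_elementary G \<longleftrightarrow> infinite (carrier G) \<and> \<not> virtually_cyclic G"

definition trivial_finite_radical :: "('a, 'b) monoid_scheme \<Rightarrow> bool" where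
  "trivial_finite_radical G \<longleftrightarrow> (\<forall>N. N \<lhd> G \<and> finite N \<longrightarrow> N = {one G})"

definition torsion_free_group :: "('a, 'b) monoid_scheme \<Rightarrow> bool" where
  "torsion_free_group G \<longleftrightarrow>
     (\<forall>x\<in>carrier G. \<forall>n::nat. n > 0 \<and> x [^]\<^bsub>G\<^esub> n = one G \<longrightarrow> x = one G)"


section \<open>The Gromov boundary\<close>

text \<open>A geodesic ray is recorded by the sequence of vertices of the Cayley graph it visits.\<close>

definition geodesic_ray :: "('a, 'b) monoid_scheme \<Rightarrow> 'a set \<Rightarrow> (nat \<Rightarrow> 'a) \<Rightarrow> bool" where
  "geodesic_ray G S \<gamma> \<longleftrightarrow>
     range \<gamma> \<subseteq> carrier G \<and> (\<forall>m n. word_dist G S (\<gamma> m) (\<gamma> n) = \<bar>real m - real n\<bar>)"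

definition finite_Hausdorff_dist :: "('a \<Rightarrow> 'a \<Rightarrow> real) \<Rightarrow> 'a set \<Rightarrow> 'a set \<Rightarrow> bool" where
  "finite_Hausdorff_dist d A B \<longleftrightarrow>
     (\<exists>C. (\<forall>a\<in>A. \<exists>b\<in>B. d a b \<le> C) \<and> (\<forall>b\<in>B. \<exists>a\<in>A. d a b \<le> C))"

definition ray_class :: "('a, 'b) monoid_scheme \<Rightarrow> 'a set \<Rightarrow> (nat \<Rightarrow> 'a) \<Rightarrow> (nat \<Rightarrow> 'a) set" where
  "ray_class G S \<gamma> =
     {\<eta>. geodesic_ray G S \<eta> \<and> finite_Hausdorff_dist (word_dist G S) (range \<gamma>) (range \<eta>)}"

definition Gromov_boundary :: "('a, 'b) monoid_scheme \<Rightarrow> 'a set \<Rightarrow> (nat \<Rightarrow> 'a) set set" where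
  "Gromov_boundary G S = ray_class G S ` {\<gamma>. geodesic_ray G S \<gamma>}"

text \<open>The topology of pointwise convergence on rays issuing from the identity. As the vertex set is
  discrete, this is also the topology of uniform convergence on bounded sets.\<close>

definition based_rays :: "('a, 'b) monoid_scheme \<Rightarrow> 'a set \<Rightarrow> (nat \<Rightarrow> 'a) topology" where
  "based_rays G S =
     subtopology (product_topology (\<lambda>_. discrete_topology (carrier G)) UNIV)
       {\<gamma>. geodesic_ray G S \<gamma> \<and> \<gamma> 0 = one G}"

text \<open>The boundary carries the quotient topology from the space of based rays.\<close>

definition boundary_topology ::
    "('a, 'b) monoid_scheme \<Rightarrow> 'a set \<Rightarrow> (nat \<Rightarrow> 'a) set topology" where
  "boundary_topology G S =
     topology (\<lambda>U. U \<subseteq> Gromov_boundary G S \<and>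
       openin (based_rays G S) {\<gamma> \<in> topspace (based_rays G S). ray_class G S \<gamma> \<in> U})"

lemma openin_boundary_topology:
  "openin (boundary_topology G S) U \<longleftrightarrow>
     U \<subseteq> Gromov_boundary G S \<and>
     openin (based_rays G S) {\<gamma> \<in> topspace (based_rays G S). ray_class G S \<gamma> \<in> U}"
proof -
  let ?R = "based_rays G S"
  let ?pre = "\<lambda>U. {\<gamma> \<in> topspace ?R. ray_class G S \<gamma> \<in> U}"
  have "istopology (\<lambda>U. U \<subseteq> Gromov_boundary G S \<and> openin ?R (?pre U))"
    unfolding istopology_def
  proof (rule conjI; intro allI impI)
    fix U V
    assume "U \<subseteq> Gromov_boundary G S \<and> openin ?R (?pre U)"
      and "V \<subseteq> Gromov_boundary G S \<and> openin ?R (?pre V)"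
    moreover have "?pre (U \<inter> V) = ?pre U \<inter> ?pre V" by blast
    ultimately show "U \<inter> V \<subseteq> Gromov_boundary G S \<and> openin ?R (?pre (U \<inter> V))"
      by (simp only: le_infI1 openin_Int)
  next
    fix \<U>
    assume *: "\<forall>U\<in>\<U>. U \<subseteq> Gromov_boundary G S \<and> openin ?R (?pre U)"
    have "?pre (\<Union>\<U>) = \<Union>(?pre ` \<U>)" by blast
    moreover have "openin ?R (\<Union>(?pre ` \<U>))" using * by (intro openin_Union) auto
    ultimately show "\<Union>\<U> \<subseteq> Gromov_boundary G S \<and> openin ?R (?pre (\<Union>\<U>))"
      using * by (simp only: Sup_least)
  qed
  then show ?thesis unfolding boundary_topology_def by simp
qed

lemma topspace_boundary_topology:
  "topspace (boundary_topology G S) = Gromov_boundary G S"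
proof
  show "topspace (boundary_topology G S) \<subseteq> Gromov_boundary G S"
    using openin_boundary_topology openin_topspace by blast
  have "{\<gamma> \<in> topspace (based_rays G S). ray_class G S \<gamma> \<in> Gromov_boundary G S} =
      topspace (based_rays G S)"
    by (auto simp: based_rays_def Gromov_boundary_def)
  then have "openin (boundary_topology G S) (Gromov_boundary G S)"
    by (simp add: openin_boundary_topology)
  then show "Gromov_boundary G S \<subseteq> topspace (boundary_topology G S)"
    by (rule openin_subset)
qed

text \<open>For a quasi-isometry \<open>\<phi>\<close>, the image of a boundary point \<open>\<xi>\<close> is the class of the geodesic rays
  staying at finite Hausdorff distance from the quasi-geodesic rays \<open>\<phi> \<circ> \<gamma>\<close> with \<open>\<gamma>\<close> in \<open>\<xi>\<close>.\<close>

definition boundary_map ::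
    "('a, 'b) monoid_scheme \<Rightarrow> 'a set \<Rightarrow> ('a \<Rightarrow> 'a) \<Rightarrow> (nat \<Rightarrow> 'a) set \<Rightarrow> (nat \<Rightarrow> 'a) set" where
  "boundary_map G S \<phi> \<xi> = (\<Union>\<gamma>\<in>\<xi>. ray_class G S (\<phi> \<circ> \<gamma>))"


section \<open>Topologically free actions\<close>

definition topologically_free ::
    "('g, 'c) monoid_scheme \<Rightarrow> 'x topology \<Rightarrow> ('g \<Rightarrow> 'x \<Rightarrow> 'x) \<Rightarrow> bool" where
  "topologically_free \<Gamma> X act \<longleftrightarrow>
     (\<forall>g \<in> carrier \<Gamma> - {one \<Gamma>}. X interior_of {x \<in> topspace X. act g x = x} = {})"

end

theory Submission
  imports Defs "HOL-Real_Asymp.Real_Asymp"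
begin

text \<open>Geodesics of an arbitrary word metric and their images under automorphisms are bilipschitz paths
  for a fixed hyperbolic word metric \<open>d\<close>, so by the Morse lemma they are governed by Gromov products of
  \<open>d\<close>. Suppose that \<open>\<phi>\<close> fixes an open set \<open>U\<close> of boundary points. A quasi-center of three points of
  \<open>U\<close> is mapped to another quasi-center of the same points, hence is moved a bounded amount, and these
  quasi-centers contain arbitrarily large balls: since the boundary has at least three points, two
  rays fork at every point of the group. Translating the balls to the identity
  and applying the pigeonhole principle shows that \<open>\<phi>\<close> is, up to a bounded error, conjugation by an
  element \<open>c\<close>. The error terms have bounded displacement, and the elements of bounded displacement form
  a finite normal subgroup, which is trivial; so \<open>\<phi>\<close> is conjugation by \<open>c\<close>, and then \<open>c\<close> is trivial.\<close>

section \<open>Gromov products in hyperbolic spaces\<close>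

text \<open>Boundary points get no Gromov products of their own. A statement about points at
  infinity is phrased as a bound on \<open>gp\<close> at group elements, valid along late points of
  rays: large products express convergence, small ones separation, and two classes are equal once
  the products are unbounded.

  Two word metrics occur: hyperbolicity is given for one finite generating set, while the boundary
  is built from another. Hyperbolicity is not transferred; the geodesics of the second metric are
  treated as bilipschitz paths for the first, so the bounds have to be uniform over all paths with a
  given bilipschitz constant.

  Of the three points of \<open>U\<close> seen from an element \<open>z\<close> of a far ball, two
  come from rays forking at \<open>z\<close> and vary with it. The third is chosen once and for all;
  its ray leaves \<gamma> long before \<open>z\<close>, so that seen from \<open>z\<close> it
  represents the direction back to the identity.\<close>

lemma log_growth:
  fixes L \<delta> :: real
  assumes "L \<ge> 1" and "\<delta> \<ge> 0"
  shows "\<exists>D0\<ge>1. \<forall>D>D0. \<exists>k::nat. L * (6 * D + 2) \<le> 2 ^ k \<and> L + (real k + 2) * \<delta> < D"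
proof -
  have "L > 0" using assms by simp
  \<comment> \<open>Here \<open>k\<close> is about the binary logarithm of
    \<open>L * (6 * D + 2)\<close>. In \<open>geodesic_near_bilip\<close> a detour of length linear
    in \<open>D\<close> costs only \<open>k\<close> times \<delta>, so a large \<open>D\<close>
    wins; the 2 in \<open>k + 2\<close> pays for \<open>gp_min3\<close>.\<close>
  then have "((\<lambda>D::real. (L + (ln (L * (6 * D + 2)) / ln 2 + 3) * \<delta>) / D) \<longlongrightarrow> 0) at_top"
    by real_asymp
  then have "\<forall>\<^sub>F D in at_top. (L + (ln (L * (6 * D + 2)) / ln 2 + 3) * \<delta>) / D < 1"
    by (rule order_tendstoD) simp
  then obtain D1 where D1: "\<And>D. D \<ge> D1 \<Longrightarrow> (L + (ln (L * (6 * D + 2)) / ln 2 + 3) * \<delta>) / D < 1"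
    by (auto simp: eventually_at_top_linorder)
  show ?thesis
  proof (intro exI[of _ "max 1 D1"] conjI allI impI)
    fix D assume D: "max 1 D1 < D"
    let ?x = "L * (6 * D + 2)"
    have "1 * 1 \<le> L * (6 * D + 2)" using assms D by (intro mult_mono) auto
    then have x: "?x \<ge> 1" by simp
    define k where "k = nat \<lceil>log 2 ?x\<rceil>"
    have l0: "log 2 ?x \<ge> 0" using x by simp
    have k1: "log 2 ?x \<le> real k" "real k \<le> log 2 ?x + 1"
      unfolding k_def using l0 by linarith+
    have "?x = 2 powr (log 2 ?x)" using x by simp
    also have "\<dots> \<le> 2 powr real k" using k1 by (intro powr_mono) auto
    also have "\<dots> = 2 ^ k" by (simp add: powr_realpow)
    finally have "?x \<le> 2 ^ k" .
    moreover have "L + (log 2 ?x + 3) * \<delta> < D"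
      using D1[of D] D by (simp add: divide_simps log_def mult.commute)
    moreover have "(real k + 2) * \<delta> \<le> (log 2 ?x + 3) * \<delta>"
      using k1 assms by (intro mult_right_mono) auto
    ultimately show "\<exists>k::nat. ?x \<le> 2 ^ k \<and> L + (real k + 2) * \<delta> < D"
      by (intro exI[of _ k]) linarith
  qed simp
qed

text \<open>The metric axioms and the four-point inequality hold on the whole type, and only
  geodesics are tied to \<open>M\<close>. They have integer parameters, as paths through the
  vertices of a Cayley graph do.\<close>

locale hyperbolic_pseudometric =
  fixes d :: "'a \<Rightarrow> 'a \<Rightarrow> real" and M :: "'a set" and \<delta> :: real
  assumes dist_refl [simp]: "d x x = 0"
    and dist_sym: "d x y = d y x"
    and dist_tri: "d x z \<le> d x y + d y z"
    and hyperbolic: "Gromov_product d w x z \<ge>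
      min (Gromov_product d w x y) (Gromov_product d w y z) - \<delta>"
    and geodesics: "x \<in> M \<Longrightarrow> y \<in> M \<Longrightarrow> \<exists>p n. p 0 = x \<and> p n = y \<and> (\<forall>i\<le>n. p i \<in> M) \<and>
      (\<forall>i\<le>n. \<forall>j\<le>n. d (p i) (p j) = \<bar>real i - real j\<bar>)"
begin

abbreviation gp :: "'a \<Rightarrow> 'a \<Rightarrow> 'a \<Rightarrow> real" where
  "gp \<equiv> Gromov_product d"

lemmas gp_def = Gromov_product_def[of d]

lemma dist_nonneg [simp]: "0 \<le> d x y"
  using dist_tri[of x x y] dist_sym[of x y] by simp

lemma delta_nonneg [simp]: "0 \<le> \<delta>"
  using hyperbolic[of undefined undefined undefined undefined] by (simp add: gp_def)

lemma gp_sym: "gp w x y = gp w y x"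
  by (simp add: gp_def dist_sym)

lemma gp_nonneg [simp]: "0 \<le> gp w x y"
  using dist_tri[of x y w] dist_sym[of x w] by (simp add: gp_def)

lemma gp_self [simp]: "gp w x x = d w x"
  by (simp add: gp_def)

lemma gp_base [simp]: "gp w w x = 0" "gp w x w = 0"
  by (simp_all add: gp_def dist_sym)

lemma gp_le_dist: "gp w x y \<le> d w x" "gp w x y \<le> d w y"
  using dist_tri[of w y x] dist_tri[of w x y] dist_sym[of x y] by (simp_all add: gp_def)

lemma gp_add: "gp x y z + gp y x z = d x y"
  using dist_sym[of x y] by (simp add: gp_def field_simps)

lemma gp_change_base: "gp w x y \<le> gp w' x y + d w w'"
  using dist_tri[of w x w'] dist_tri[of w y w'] by (simp add: gp_def field_simps)

lemma gp_change_arg: "gp w x y \<le> gp w x' y + d x x'"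
  using dist_tri[of w x x'] dist_tri[of x' y x] dist_sym[of x x']
  by (simp add: gp_def field_simps)

lemma gp_ge_dist: "gp w x y \<ge> d w x - d x y"
  using dist_tri[of w x y] dist_sym[of x y] by (simp add: gp_def)

lemma gp_min3: "gp w x z \<ge> min (gp w x y) (min (gp w y y') (gp w y' z)) - 2 * \<delta>"
  using hyperbolic[of w x y z] hyperbolic[of w y y' z] delta_nonneg by linarith

text \<open>At most one of the products of \<open>z\<close> with \<open>a\<close>, \<open>b\<close>, \<open>c\<close> at \<open>y\<close> is large, and the same holds with
  \<open>y\<close> and \<open>z\<close> exchanged, so for one of the three points both are small; they add up to \<open>d y z\<close>.\<close>

lemma quasi_centers_close:
  fixes a b c :: 'a
  assumes "gp y a b \<le> K" "gp y a c \<le> K" "gp y b c \<le> K"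
    and "gp z a b \<le> K'" "gp z a c \<le> K'" "gp z b c \<le> K'"
  shows "d y z \<le> K + K' + 2 * \<delta>"
proof -
  have s: "gp u v w = gp u w v" for u v w by (rule gp_sym)
  have "gp y z a + gp z y a = d y z" "gp y z b + gp z y b = d y z" "gp y z c + gp z y c = d y z"
    by (rule gp_add)+
  moreover have "min (gp y z a) (gp y z b) \<le> K + \<delta>" "min (gp y z a) (gp y z c) \<le> K + \<delta>"
    "min (gp y z b) (gp y z c) \<le> K + \<delta>"
    using hyperbolic[of y a z b] hyperbolic[of y a z c] hyperbolic[of y b z c] assms
      s[of y z a] s[of y z b] s[of y z c] by linarith+
  moreover have "min (gp z y a) (gp z y b) \<le> K' + \<delta>" "min (gp z y a) (gp z y c) \<le> K' + \<delta>"
    "min (gp z y b) (gp z y c) \<le> K' + \<delta>"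
    using hyperbolic[of z a y b] hyperbolic[of z a y c] hyperbolic[of z b y c] assms
      s[of z y a] s[of z y b] s[of z y c] by linarith+
  ultimately show ?thesis by linarith
qed

text \<open>In a tree the branch point of \<open>x\<close>, \<open>y\<close>, \<open>z\<close> lies
  on the segment from \<open>x\<close> to \<open>y\<close> at distance \<open>gp x y z\<close> from
  \<open>x\<close>. The vertex at the rounded-down distance is taken; the summand 1 absorbs the
  rounding.\<close>

lemma quasi_center_exists:
  assumes "x \<in> M" "y \<in> M"
  shows "\<exists>c\<in>M. gp c x y \<le> \<delta> + 1 \<and> gp c x z \<le> \<delta> + 1 \<and> gp c y z \<le> \<delta> + 1"
proof -
  obtain p n where p: "p 0 = x" "p n = y" "\<forall>i\<le>n. p i \<in> M"
    "\<And>i j. i \<le> n \<Longrightarrow> j \<le> n \<Longrightarrow> d (p i) (p j) = \<bar>real i - real j\<bar>"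
    using geodesics[OF assms] by blast
  define t where "t = gp x y z"
  define k where "k = nat \<lfloor>t\<rfloor>"
  have n: "d x y = real n" using p(4)[of 0 n] p(1,2) by simp
  have t: "0 \<le> t" "t \<le> real n" unfolding t_def n[symmetric] by (simp_all add: gp_le_dist)
  have k: "real k \<le> t" "t < real k + 1" unfolding k_def using t by linarith+
  then have kn: "k \<le> n" using t by linarith
  define c where "c = p k"
  have c: "d x c = real k" "d c y = real n - real k"
    using p(4)[of 0 k] p(4)[of k n] kn p(1,2) by (simp_all add: c_def)
  have c': "d c x = real k" "d y c = real n - real k" "d y x = real n"
    using c n dist_sym by metis+
  have 1: "gp c x y = 0" using c c' n by (simp add: gp_def)
  have "gp x c y = real k" "gp y c x = real n - real k" using c c' n by (simp_all add: gp_def)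
  moreover have "gp x y z + gp y x z = real n" using gp_add n by metis
  moreover have "gp c x z + gp x c z = real k" "gp c y z + gp y c z = real n - real k"
    using gp_add c c' by metis+
  moreover have "gp x c z \<ge> min (gp x c y) (gp x y z) - \<delta>" "gp y c z \<ge> min (gp y c x) (gp y x z) - \<delta>"
    by (rule hyperbolic)+
  ultimately have "gp c x z \<le> \<delta> + 1" "gp c y z \<le> \<delta> + 1" using k t_def by linarith+
  moreover have "gp c x y \<le> \<delta> + 1" using 1 delta_nonneg by linarith
  moreover have "c \<in> M" using p(3) kn c_def by blast
  ultimately show ?thesis by blast
qed

section \<open>The Morse lemma for bilipschitz paths\<close>

lemma gp_chain:
  assumes "\<And>i. i < n \<Longrightarrow> gp w (f i) (f (Suc i)) \<ge> B" and "1 \<le> n" and "n \<le> 2 ^ k"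
  shows "gp w (f 0) (f n) \<ge> B - real k * \<delta>"
  using assms
proof (induction k arbitrary: f n)
  case 0
  then have "n = 1" by simp
  then show ?case using 0(1)[of 0] by simp
next
  case (Suc k)
  show ?case
  proof (cases "n \<le> 2 ^ k")
    case True
    then have "gp w (f 0) (f n) \<ge> B - real k * \<delta>" using Suc by blast
    moreover have "real (Suc k) * \<delta> = real k * \<delta> + \<delta>" by (simp add: algebra_simps)
    ultimately show ?thesis using delta_nonneg by linarith
  next
    case False
    \<comment> \<open>Each halving of the chain costs one \<delta>, so the total loss is logarithmic
      in the length rather than linear.\<close>
    define m :: nat where "m = 2 ^ k"
    have m: "1 \<le> m" "m < n" "n - m \<le> 2 ^ k" using False Suc.prems(3) by (auto simp: m_def)
    have "gp w (f 0) (f m) \<ge> B - real k * \<delta>"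
      using Suc.IH[of m f] Suc.prems(1) m by (simp add: m_def)
    moreover have "gp w (f (m + 0)) (f (m + (n - m))) \<ge> B - real k * \<delta>"
      using Suc.IH[of "n - m" "\<lambda>i. f (m + i)"] Suc.prems(1) m by simp
    ultimately show ?thesis
      using hyperbolic[of w "f 0" "f m" "f n"] m delta_nonneg by (simp add: algebra_simps)
  qed
qed

text \<open>A discrete quasi-geodesic without additive error, which suffices for geodesics of
  another word metric and for their images under automorphisms. The endpoints lie in
  \<open>M\<close> so that a geodesic joins them.\<close>

definition bilip :: "real \<Rightarrow> (nat \<Rightarrow> 'a) \<Rightarrow> nat \<Rightarrow> bool" where
  "bilip L c n \<longleftrightarrow> c 0 \<in> M \<and> c n \<in> M \<and> (\<forall>i\<le>n. \<forall>j\<le>n. d (c i) (c j) \<le> L * \<bar>real i - real j\<bar> \<and>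
     \<bar>real i - real j\<bar> \<le> L * d (c i) (c j))"

lemma bilip_dist_le:
  assumes "bilip L c n" "i \<le> n" "j \<le> n"
  shows "d (c i) (c j) \<le> L * \<bar>real i - real j\<bar>" "\<bar>real i - real j\<bar> \<le> L * d (c i) (c j)"
  using assms unfolding bilip_def by blast+

text \<open>Consecutive points are at most \<open>L\<close> apart and at least \<open>D\<close> away
  from \<open>w\<close>, so their product at \<open>w\<close> is at least \<open>D - L\<close>;
  \<open>gp_chain\<close> carries this bound along the path.\<close>

lemma gp_detour:
  assumes c: "bilip L c n" and far: "\<And>i. i \<le> n \<Longrightarrow> D \<le> d w (c i)" and "L \<ge> 1"
    and "a \<le> n" "b \<le> n" "\<bar>real a - real b\<bar> \<le> 2 ^ k"
  shows "gp w (c a) (c b) \<ge> D - L - real k * \<delta>"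
proof (cases "a = b")
  case True
  have "0 \<le> real k * \<delta>" by simp
  then have "D - L - real k * \<delta> \<le> d w (c a)" using far[OF assms(4)] assms(3) by linarith
  then show ?thesis using True by simp
next
  case False
  have step: "gp w (c i) (c j) \<ge> D - L" if "i \<le> n" "j \<le> n" "\<bar>real i - real j\<bar> = 1" for i j
  proof -
    have "d (c i) (c j) \<le> L" using bilip_dist_le[OF c that(1,2)] that(3) by simp
    then show ?thesis using far[OF that(1)] far[OF that(2)] assms(3) by (simp add: gp_def)
  qed
  have main: "gp w (c a) (c b) \<ge> D - L - real k * \<delta>"
    if "a \<le> n" "b \<le> n" "a < b" "real b - real a \<le> 2 ^ k" for a b
  proof -
    have "gp w (c (a + 0)) (c (a + (b - a))) \<ge> D - L - real k * \<delta>"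
    proof (rule gp_chain[where f = "\<lambda>i. c (a + i)"])
      have "real (b - a) \<le> real (2 ^ k)" using that by simp
      then show "b - a \<le> 2 ^ k" by (simp only: of_nat_le_iff)
    qed (use that step in auto)
    then show ?thesis using that by simp
  qed
  show ?thesis
    using False main[of a b] main[of b a] assms(4-6) gp_sym[of w "c a" "c b"] by (cases "a < b") auto
qed

text \<open>At a point \<open>w\<close> of the geodesic farthest from the path, the Gromov product of two points of the
  geodesic on either side is zero, whereas a detour along the path makes it large.\<close>

lemma geodesic_near_bilip:
  assumes "L \<ge> 1"
  obtains D where "D \<ge> 1" and "\<And>c n g m j. bilip L c n \<Longrightarrow> g 0 = c 0 \<Longrightarrow> g m = c n \<Longrightarrow>
    (\<And>i j. i \<le> m \<Longrightarrow> j \<le> m \<Longrightarrow> d (g i) (g j) = \<bar>real i - real j\<bar>) \<Longrightarrow> j \<le> m \<Longrightarrow>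
    \<exists>i\<le>n. d (g j) (c i) \<le> D"
proof -
  obtain D0 where "D0 \<ge> 1" and
    D0: "\<And>D. D > D0 \<Longrightarrow> \<exists>k::nat. L * (6 * D + 2) \<le> 2 ^ k \<and> L + (real k + 2) * \<delta> < D"
    using log_growth[OF assms delta_nonneg] by blast
  have "\<exists>i\<le>n. d (g j) (c i) \<le> D0"
    if c: "bilip L c n" and g0: "g 0 = c 0" and gm: "g m = c n" and
      geo: "\<And>i j. i \<le> m \<Longrightarrow> j \<le> m \<Longrightarrow> d (g i) (g j) = \<bar>real i - real j\<bar>" and "j \<le> m"
    for c n g m j
  proof (rule ccontr)
    assume neg: "\<not> (\<exists>i\<le>n. d (g j) (c i) \<le> D0)"
    define h where "h j = Min ((\<lambda>i. d (g j) (c i)) ` {..n})" for j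
    have h_le: "h j \<le> d (g j) (c i)" if "i \<le> n" for i j
      unfolding h_def using that by (intro Min_le) auto
    have h_ex: "\<exists>i\<le>n. d (g j) (c i) = h j" for j
    proof -
      have "h j \<in> (\<lambda>i. d (g j) (c i)) ` {..n}" unfolding h_def by (intro Min_in) auto
      then show ?thesis by auto
    qed
    define D where "D = Max (h ` {..m})"
    have "D \<in> h ` {..m}" unfolding D_def by (intro Max_in) auto
    then obtain j0 where j0: "j0 \<le> m" "D = h j0" by auto
    have D_ge: "h j \<le> D" if "j \<le> m" for j
      unfolding D_def using that by (intro Max_ge) auto
    have "D > D0" using h_ex[of j] D_ge[OF \<open>j \<le> m\<close>] neg by force
    then obtain k where k: "L * (6 * D + 2) \<le> 2 ^ k" "L + (real k + 2) * \<delta> < D"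
      using D0 by blast
    define w where "w = g j0"
    have far: "D \<le> d w (c i)" if "i \<le> n" for i using h_le[OF that] j0 w_def by simp
    \<comment> \<open>At distance about \<open>2 * D\<close> from \<open>w\<close> along the
      geodesic, a path point within \<open>D\<close> of the geodesic point still has product at
      least \<open>D\<close> with it: the three distances contribute at least \<open>2 * D\<close>,
      \<open>D\<close> and \<open>-D\<close>, and the sum is halved. If the geodesic ends earlier,
      its endpoint is itself a point of the path.\<close>
    define k2 where "k2 = nat \<lceil>2 * D\<rceil>"
    have k2: "2 * D \<le> real k2" "real k2 \<le> 2 * D + 1"
      unfolding k2_def using \<open>D > D0\<close> \<open>D0 \<ge> 1\<close> by linarith+
    have near: "\<exists>i\<le>n. gp w (g l) (c i) \<ge> D \<and> d w (c i) \<le> 3 * D + 1"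
      if "l \<le> m" "\<bar>real l - real j0\<bar> \<le> real k2"
        "\<bar>real l - real j0\<bar> = real k2 \<or> l = 0 \<or> l = m" for l
    proof -
      have dwl: "d w (g l) = \<bar>real l - real j0\<bar>" using geo[of j0 l] j0 that w_def by auto
      have "(\<exists>i\<le>n. g l = c i) \<or> \<bar>real l - real j0\<bar> = real k2"
        using that(3) g0 gm by blast
      then consider i where "i \<le> n" "g l = c i" | "\<bar>real l - real j0\<bar> = real k2" by blast
      then show ?thesis
      proof cases
        case 1
        then have "gp w (g l) (c i) \<ge> D" "d w (c i) \<le> 3 * D + 1"
          using far[of i] dwl that(2) k2 \<open>D > D0\<close> \<open>D0 \<ge> 1\<close> by simp_all
        then show ?thesis using 1 by blast
      next
        case 2
        obtain i where i: "i \<le> n" "d (g l) (c i) = h l" using h_ex by blast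
        then have le: "d (g l) (c i) \<le> D" using D_ge that(1) by simp
        have "d w (c i) \<le> 3 * D + 1" using le dwl 2 k2 dist_tri[of w "c i" "g l"] by linarith
        moreover have "gp w (g l) (c i) \<ge> D" using le dwl 2 k2 far[OF i(1)] by (simp add: gp_def)
        ultimately show ?thesis using i by blast
      qed
    qed
    \<comment> \<open>Truncated subtraction is intended: \<open>l1\<close> is 0 when the start of
      the geodesic is reached within \<open>k2\<close> steps, just as \<open>l2\<close> is cut off
      at \<open>m\<close>.\<close>
    define l1 where "l1 = j0 - k2"
    define l2 where "l2 = min m (j0 + k2)"
    have l: "l1 \<le> j0" "j0 \<le> l2" "l1 \<le> m" "l2 \<le> m" using j0 by (auto simp: l1_def l2_def)
    have "\<bar>real l1 - real j0\<bar> = real k2 \<or> l1 = 0" "\<bar>real l1 - real j0\<bar> \<le> real k2"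
      by (auto simp: l1_def)
    then obtain i1 where i1: "i1 \<le> n" "gp w (g l1) (c i1) \<ge> D" "d w (c i1) \<le> 3 * D + 1"
      using near[of l1] l by blast
    have "\<bar>real l2 - real j0\<bar> = real k2 \<or> l2 = m" "\<bar>real l2 - real j0\<bar> \<le> real k2"
      using j0 by (auto simp: l2_def min_def)
    then obtain i2 where i2: "i2 \<le> n" "gp w (g l2) (c i2) \<ge> D" "d w (c i2) \<le> 3 * D + 1"
      using near[of l2] l by blast
    have "d (c i1) (c i2) \<le> 6 * D + 2"
      using dist_tri[of "c i1" "c i2" w] dist_sym[of w "c i1"] i1 i2 by linarith
    then have "L * d (c i1) (c i2) \<le> L * (6 * D + 2)" using assms by (intro mult_left_mono) auto
    then have "\<bar>real i1 - real i2\<bar> \<le> 2 ^ k"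
      using bilip_dist_le(2)[OF c i1(1) i2(1)] k(1) by linarith
    then have "gp w (c i1) (c i2) \<ge> D - L - real k * \<delta>"
      using gp_detour[OF c far assms i1(1) i2(1)] by blast
    then have "gp w (g l1) (g l2) \<ge> D - L - real k * \<delta> - 2 * \<delta>"
      using gp_min3[of w "g l1" "c i1" "c i2" "g l2"] i1 i2 gp_sym[of w "g l2" "c i2"] assms
        mult_nonneg_nonneg[OF of_nat_0_le_iff[of k] delta_nonneg] by linarith
    moreover have "gp w (g l1) (g l2) = 0"
      unfolding gp_def w_def using geo[of j0 l1] geo[of j0 l2] geo[of l1 l2] l j0 by auto
    ultimately show False using k(2) by (simp add: algebra_simps)
  qed
  then show thesis by (rule that[OF \<open>D0 \<ge> 1\<close>])
qed

text \<open>Points of the geodesic are marked \<open>P\<close> or \<open>Q\<close> according to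
  whether they are near the path before or after the index \<open>k\<close>. The start is
  \<open>P\<close> and the end is \<open>Q\<close>, so two marks meet at points at most one step
  apart. The two path points found there are close together and their indices enclose
  \<open>k\<close>, so \<open>c k\<close> is close to the geodesic, at whose points the product of
  the endpoints vanishes.\<close>

theorem Morse_gp:
  assumes "L \<ge> 1"
  obtains D where "D \<ge> 0" and "\<And>c n k. bilip L c n \<Longrightarrow> k \<le> n \<Longrightarrow> gp (c k) (c 0) (c n) \<le> D"
proof -
  obtain D where "D \<ge> 1" and D: "\<And>c n g m j. bilip L c n \<Longrightarrow> g 0 = c 0 \<Longrightarrow> g m = c n \<Longrightarrow>
      (\<And>i j. i \<le> m \<Longrightarrow> j \<le> m \<Longrightarrow> d (g i) (g j) = \<bar>real i - real j\<bar>) \<Longrightarrow> j \<le> m \<Longrightarrow>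
      \<exists>i\<le>n. d (g j) (c i) \<le> D"
    using geodesic_near_bilip[OF assms] by metis
  have "gp (c k) (c 0) (c n) \<le> D + L * (L * (2 * D + 1))" if c: "bilip L c n" and k: "k \<le> n" for c n k
  proof -
    obtain g m where g: "g 0 = c 0" "g m = c n"
      "\<And>i j. i \<le> m \<Longrightarrow> j \<le> m \<Longrightarrow> d (g i) (g j) = \<bar>real i - real j\<bar>"
      using geodesics[of "c 0" "c n"] c unfolding bilip_def by blast
    define P where "P j \<longleftrightarrow> (\<exists>i\<le>k. d (g j) (c i) \<le> D)" for j
    define Q where "Q j \<longleftrightarrow> (\<exists>i\<le>n. k \<le> i \<and> d (g j) (c i) \<le> D)" for j
    have PQ: "P j \<or> Q j" if "j \<le> m" for j
      using D[OF c g that, simplified] unfolding P_def Q_def by (meson linear)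
    have "P 0" unfolding P_def using g \<open>D \<ge> 1\<close> by (intro exI[of _ 0]) simp
    define j where "j = Max {j. j \<le> m \<and> P j}"
    have fin: "finite {j. j \<le> m \<and> P j}" by simp
    have "j \<in> {j. j \<le> m \<and> P j}" unfolding j_def using \<open>P 0\<close> by (intro Max_in) auto
    then have j: "j \<le> m" "P j" by auto
    have "\<exists>j'\<le>m. \<bar>real j - real j'\<bar> \<le> 1 \<and> Q j'"
    proof (cases "j = m")
      case True
      have "Q m" unfolding Q_def using g \<open>D \<ge> 1\<close> k by (intro exI[of _ n]) simp
      then show ?thesis using True by auto
    next
      case False
      then have "\<not> P (Suc j)" using Max_ge[OF fin, of "Suc j"] j unfolding j_def[symmetric] by auto
      then show ?thesis using PQ[of "Suc j"] False j by (intro exI[of _ "Suc j"]) auto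
    qed
    then obtain j' where j': "j' \<le> m" "\<bar>real j - real j'\<bar> \<le> 1" "Q j'" by blast
    obtain i i' where i: "i \<le> k" "d (g j) (c i) \<le> D" and i': "i' \<le> n" "k \<le> i'" "d (g j') (c i') \<le> D"
      using j(2) j'(3) unfolding P_def Q_def by blast
    have gj: "d (g j) (g j') \<le> 1" using g(3) j j' by simp
    have "d (c i) (c i') \<le> 2 * D + 1"
      using dist_tri[of "c i" "c i'" "g j"] dist_tri[of "g j" "c i'" "g j'"] dist_sym[of "c i" "g j"] i i' gj
      by linarith
    then have "L * d (c i) (c i') \<le> L * (2 * D + 1)" using assms by (intro mult_left_mono) auto
    then have "\<bar>real i - real i'\<bar> \<le> L * (2 * D + 1)"
      using bilip_dist_le(2)[OF c, of i i'] i i' by linarith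
    then have "\<bar>real k - real i\<bar> \<le> L * (2 * D + 1)" using i i' by linarith
    then have "L * \<bar>real k - real i\<bar> \<le> L * (L * (2 * D + 1))" using assms by (intro mult_left_mono) auto
    then have "d (c k) (c i) \<le> L * (L * (2 * D + 1))"
      using bilip_dist_le(1)[OF c, of k i] i k by linarith
    then have "d (c k) (g j) \<le> D + L * (L * (2 * D + 1))"
      using dist_tri[of "c k" "g j" "c i"] dist_sym[of "c i" "g j"] i by linarith
    moreover have "gp (g j) (c 0) (c n) = 0"
    proof -
      have "d (g j) (g 0) = real j" "d (g j) (g m) = real m - real j" "d (g 0) (g m) = real m"
        using g(3) j(1) by auto
      then show ?thesis by (simp add: gp_def flip: g(1,2))
    qed
    ultimately show ?thesis using gp_change_base[of "c k" "c 0" "c n" "g j"] by linarith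
  qed
  moreover have "D + L * (L * (2 * D + 1)) \<ge> 0" using assms \<open>D \<ge> 1\<close> by simp
  ultimately show thesis by (metis that)
qed

text \<open>A discrete intermediate value argument. At the first index where the product with
  \<open>c 0\<close> at \<open>z\<close> has dropped to \<open>K\<close> plus \<delta>, the product
  with \<open>c n\<close> is small as well, since its predecessor still points towards
  \<open>c 0\<close>. As \<open>c i\<close> lies almost between the endpoints, two small products at
  \<open>z\<close> force \<open>z\<close> to be close to \<open>c i\<close>.\<close>

lemma near_bilip:
  assumes "L \<ge> 1"
  obtains C where "\<And>c n z K. bilip L c n \<Longrightarrow> gp z (c 0) (c n) \<le> K \<Longrightarrow> \<exists>i\<le>n. d z (c i) \<le> 2 * K + C"
proof -
  obtain D where D: "\<And>c n k. bilip L c n \<Longrightarrow> k \<le> n \<Longrightarrow> gp (c k) (c 0) (c n) \<le> D"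
    using Morse_gp[OF assms] by metis
  have "\<exists>i\<le>n. d z (c i) \<le> 2 * K + (2 * \<delta> + L + D)" if c: "bilip L c n" and K: "gp z (c 0) (c n) \<le> K" for c n z K
  proof -
    define A where "A i \<longleftrightarrow> gp z (c 0) (c i) \<le> K + \<delta>" for i
    define i where "i = (LEAST i. A i)"
    have An: "A n" unfolding A_def using K delta_nonneg by linarith
    have i: "A i" "i \<le> n" unfolding i_def by (rule LeastI[of A], rule An, rule Least_le, rule An)
    have "gp z (c i) (c n) \<le> K + \<delta> + L"
    proof (cases i)
      case 0
      have "gp z (c 0) (c n) \<le> K + \<delta> + L" using K delta_nonneg assms by linarith
      then show ?thesis using 0 by simp
    next
      case (Suc l)
      then have "\<not> A l" using not_less_Least[of l A] by (simp add: i_def)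
      then have "gp z (c l) (c n) \<le> K + \<delta>"
        using hyperbolic[of z "c 0" "c l" "c n"] K unfolding A_def by linarith
      moreover have "d (c i) (c l) \<le> L" using bilip_dist_le(1)[OF c, of i l] i Suc by simp
      ultimately show ?thesis using gp_change_arg[of z "c i" "c n" "c l"] by linarith
    qed
    moreover have "gp z (c 0) (c i) \<le> K + \<delta>" using i A_def by simp
    moreover have "gp (c i) (c 0) (c n) \<le> D" using D[OF c i(2)] .
    moreover have "d (c 0) (c n) \<le> d z (c 0) + d z (c n)"
      using dist_tri[of "c 0" "c n" z] dist_sym[of z "c 0"] by linarith
    ultimately have "d z (c i) \<le> 2 * K + (2 * \<delta> + L + D)"
      unfolding gp_def using dist_sym[of "c 0" "c i"] by (simp add: field_simps)
    then show ?thesis using i by blast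
  qed
  then show thesis by (rule that)
qed

text \<open>A small product places \<open>c\<close> near a geodesic from \<open>a\<close> to
  \<open>b\<close>. The image of this geodesic is a bilipschitz path, to which
  \<open>Morse_gp\<close> applies. This is what carries quasi-centers to quasi-centers.\<close>

lemma gp_distortion:
  assumes "\<mu> \<ge> 1" and "\<And>x. x \<in> M \<Longrightarrow> f x \<in> M"
    and "\<And>x y. x \<in> M \<Longrightarrow> y \<in> M \<Longrightarrow> d (f x) (f y) \<le> \<mu> * d x y \<and> d x y \<le> \<mu> * d (f x) (f y)"
  obtains K' where "\<And>a b c. a \<in> M \<Longrightarrow> b \<in> M \<Longrightarrow> c \<in> M \<Longrightarrow> gp c a b \<le> K \<Longrightarrow> gp (f c) (f a) (f b) \<le> K'"
proof -
  obtain C where C: "\<And>c n z K. bilip 1 c n \<Longrightarrow> gp z (c 0) (c n) \<le> K \<Longrightarrow> \<exists>i\<le>n. d z (c i) \<le> 2 * K + C"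
    using near_bilip[OF order_refl] by metis
  obtain D where D: "\<And>c n k. bilip \<mu> c n \<Longrightarrow> k \<le> n \<Longrightarrow> gp (c k) (c 0) (c n) \<le> D"
    using Morse_gp[OF assms(1)] by metis
  have "gp (f c) (f a) (f b) \<le> D + \<mu> * (2 * K + C)"
    if abc: "a \<in> M" "b \<in> M" "c \<in> M" "gp c a b \<le> K" for a b c
  proof -
    obtain p n where p: "p 0 = a" "p n = b" "\<forall>i\<le>n. p i \<in> M"
      "\<forall>i\<le>n. \<forall>j\<le>n. d (p i) (p j) = \<bar>real i - real j\<bar>"
      using geodesics[OF abc(1,2)] by blast
    have "bilip 1 p n" unfolding bilip_def using p by auto
    then obtain i where i: "i \<le> n" "d c (p i) \<le> 2 * K + C" using C[of p n c K] p abc by auto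
    have "d (f (p i)) (f (p j)) \<le> \<mu> * \<bar>real i - real j\<bar> \<and> \<bar>real i - real j\<bar> \<le> \<mu> * d (f (p i)) (f (p j))"
      if "i \<le> n" "j \<le> n" for i j
      using assms(3)[of "p i" "p j"] p(3,4) that by simp
    then have "bilip \<mu> (\<lambda>i. f (p i)) n"
      unfolding bilip_def using p(1-3) assms(2) abc by blast
    then have "gp (f (p i)) (f a) (f b) \<le> D" using D[of "\<lambda>i. f (p i)" n i] i p by auto
    moreover have "d (f c) (f (p i)) \<le> \<mu> * (2 * K + C)"
    proof -
      have "d (f c) (f (p i)) \<le> \<mu> * d c (p i)" using assms(3) abc p i by blast
      also have "\<dots> \<le> \<mu> * (2 * K + C)" using i assms(1) by (intro mult_left_mono) auto
      finally show ?thesis .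
    qed
    ultimately show ?thesis using gp_change_base[of "f c" "f a" "f b" "f (p i)"] by linarith
  qed
  then show thesis by (rule that)
qed

end

section \<open>Word metrics\<close>

lemma (in group) inv_mult_cancel [simp]:
  assumes "x \<in> carrier G" "y \<in> carrier G"
  shows "x \<otimes> (inv x \<otimes> y) = y" "inv x \<otimes> (x \<otimes> y) = y"
  using assms by (simp_all flip: m_assoc)

locale generated_group = group G for G (structure) +
  fixes S :: "'a set"
  assumes gen: "finite_generating_set G S"
begin

abbreviation letters :: "'a set" where "letters \<equiv> S \<union> m_inv G ` S"
abbreviation word_prod :: "'a list \<Rightarrow> 'a" where "word_prod ws \<equiv> foldr (\<otimes>) ws \<one>"
abbreviation wl :: "'a \<Rightarrow> nat" where "wl \<equiv> word_length G S"
abbreviation wd :: "'a \<Rightarrow> 'a \<Rightarrow> real" where "wd \<equiv> word_dist G S"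

lemma generators_closed: "S \<subseteq> carrier G" "letters \<subseteq> carrier G"
  using gen by (auto simp: finite_generating_set_def)

lemma word_prod_closed: "set ws \<subseteq> carrier G \<Longrightarrow> word_prod ws \<in> carrier G"
  by (induction ws) auto

lemma word_prod_append:
  "set ws \<subseteq> carrier G \<Longrightarrow> set vs \<subseteq> carrier G \<Longrightarrow> word_prod (ws @ vs) = word_prod ws \<otimes> word_prod vs"
  by (induction ws) (auto simp: word_prod_closed m_assoc)

lemma word_prod_inv:
  "set ws \<subseteq> carrier G \<Longrightarrow> inv (word_prod ws) = word_prod (rev (map (m_inv G) ws))"
proof (induction ws)
  case (Cons w ws)
  have "word_prod (rev (map (m_inv G) ws) @ [inv w]) = word_prod (rev (map (m_inv G) ws)) \<otimes> word_prod [inv w]"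
    using Cons.prems by (intro word_prod_append) auto
  then show ?case using Cons by (simp add: inv_mult_group word_prod_closed)
qed simp

lemma word_exists:
  assumes "x \<in> carrier G"
  shows "\<exists>ws. set ws \<subseteq> letters \<and> word_prod ws = x"
proof -
  have "x \<in> generate G S" using assms gen by (simp add: finite_generating_set_def)
  then show ?thesis
  proof (induction rule: generate.induct)
    case one
    show ?case by (intro exI[of _ "[]"]) simp
  next
    case (incl h)
    then show ?case using generators_closed by (intro exI[of _ "[h]"]) auto
  next
    case (inv h)
    then show ?case using generators_closed by (intro exI[of _ "[inv h]"]) auto
  next
    case (eng h1 h2)
    then obtain ws vs where "set ws \<subseteq> letters" "word_prod ws = h1" "set vs \<subseteq> letters" "word_prod vs = h2"
      by blast
    moreover have "word_prod (ws @ vs) = word_prod ws \<otimes> word_prod vs"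
      by (rule word_prod_append) (use calculation generators_closed in auto)
    ultimately show ?case by (intro exI[of _ "ws @ vs"]) simp
  qed
qed

lemma wl_le:
  assumes "set ws \<subseteq> letters" "word_prod ws = x" "length ws \<le> n"
  shows "wl x \<le> n"
proof -
  have "wl x \<le> length ws" unfolding word_length_def by (rule Least_le) (use assms in blast)
  then show ?thesis using assms by simp
qed

lemma shortest_word:
  assumes "x \<in> carrier G"
  obtains ws where "set ws \<subseteq> letters" "word_prod ws = x" "length ws = wl x"
proof -
  have "\<exists>n ws. length ws = n \<and> set ws \<subseteq> letters \<and> word_prod ws = x"
    using word_exists[OF assms] by blast
  from LeastI_ex[OF this] show thesis
    unfolding word_length_def[symmetric] using that by blast
qed

lemma wl_one [simp]: "wl \<one> = 0"
  using wl_le[of "[]" \<one> 0] by simp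

lemma wl_mult:
  assumes "x \<in> carrier G" "y \<in> carrier G"
  shows "wl (x \<otimes> y) \<le> wl x + wl y"
proof -
  obtain ws vs where ws: "set ws \<subseteq> letters" "word_prod ws = x" "length ws = wl x"
    and vs: "set vs \<subseteq> letters" "word_prod vs = y" "length vs = wl y"
    using shortest_word assms by metis
  have "word_prod (ws @ vs) = x \<otimes> y"
    using word_prod_append[of ws vs] ws vs generators_closed by auto
  then show ?thesis using wl_le[of "ws @ vs"] ws vs by simp
qed

lemma wl_inv_le:
  assumes "x \<in> carrier G"
  shows "wl (inv x) \<le> wl x"
proof -
  obtain ws where ws: "set ws \<subseteq> letters" "word_prod ws = x" "length ws = wl x"
    using shortest_word assms by metis
  have "set (rev (map (m_inv G) ws)) \<subseteq> letters"
    using ws(1) generators_closed by (auto simp: subset_iff image_iff)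
  moreover have "set ws \<subseteq> carrier G" using ws(1) generators_closed(2) by (rule order_trans)
  ultimately show ?thesis
    using wl_le[of "rev (map (m_inv G) ws)" "inv x" "wl x"] word_prod_inv[of ws] ws by simp
qed

lemma wl_inv [simp]: "x \<in> carrier G \<Longrightarrow> wl (inv x) = wl x"
  using wl_inv_le[of x] wl_inv_le[of "inv x"] by simp

lemma finite_ball_wl: "finite {x \<in> carrier G. wl x \<le> n}"
proof (rule finite_surj)
  have "finite letters" using gen by (simp add: finite_generating_set_def)
  then show "finite {ws. set ws \<subseteq> letters \<and> length ws \<le> n}" by (rule finite_lists_length_le)
  show "{x \<in> carrier G. wl x \<le> n} \<subseteq> word_prod ` {ws. set ws \<subseteq> letters \<and> length ws \<le> n}"
    using shortest_word by (smt (verit) image_iff mem_Collect_eq subsetI)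
qed

lemma wd_eq: "wd x y = real (wl (inv x \<otimes> y))"
  by (simp add: word_dist_def)

lemma wd_refl [simp]: "x \<in> carrier G \<Longrightarrow> wd x x = 0"
  by (simp add: wd_eq)

lemma wd_sym: "x \<in> carrier G \<Longrightarrow> y \<in> carrier G \<Longrightarrow> wd x y = wd y x"
  using wl_inv[of "inv x \<otimes> y"] by (simp add: wd_eq inv_mult_group)

lemma wd_tri:
  assumes "x \<in> carrier G" "y \<in> carrier G" "z \<in> carrier G"
  shows "wd x z \<le> wd x y + wd y z"
proof -
  have "(inv x \<otimes> y) \<otimes> (inv y \<otimes> z) = inv x \<otimes> z"
    using assms by (simp add: m_assoc)
  then show ?thesis
    using wl_mult[of "inv x \<otimes> y" "inv y \<otimes> z"] assms by (simp add: wd_eq)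
qed

lemma wd_left_invariant:
  assumes "g \<in> carrier G" "x \<in> carrier G" "y \<in> carrier G"
  shows "wd (g \<otimes> x) (g \<otimes> y) = wd x y"
proof -
  have "inv (g \<otimes> x) \<otimes> (g \<otimes> y) = inv x \<otimes> y"
    using assms by (simp add: inv_mult_group m_assoc)
  then show ?thesis by (simp add: wd_eq)
qed

text \<open>The vertices are \<open>x\<close> times the prefixes of a shortest word. Two prefixes
  differ by at most the number of letters between them, and the total being \<open>n\<close> leaves
  no slack. Beyond \<open>n\<close> the path is constant, hence \<open>p i\<close> is in the group
  for every \<open>i\<close>.\<close>

lemma wd_geodesic:
  assumes "x \<in> carrier G" "y \<in> carrier G"
  obtains p n where "p 0 = x" "p n = y" "\<And>i. p i \<in> carrier G"
    "\<And>i j. i \<le> n \<Longrightarrow> j \<le> n \<Longrightarrow> wd (p i) (p j) = \<bar>real i - real j\<bar>"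
proof -
  obtain ws where ws: "set ws \<subseteq> letters" "word_prod ws = inv x \<otimes> y" "length ws = wl (inv x \<otimes> y)"
    using shortest_word[of "inv x \<otimes> y"] assms by auto
  define n where "n = length ws"
  define p where "p i = x \<otimes> word_prod (take i ws)" for i
  have sub: "set (take i ws) \<subseteq> letters" "set (take i ws) \<subseteq> carrier G"
    "set (drop i ws) \<subseteq> letters" "set (drop i ws) \<subseteq> carrier G" for i
    using ws(1) generators_closed(2) set_take_subset[of i ws] set_drop_subset[of i ws] by blast+
  have cl: "p i \<in> carrier G" for i
    using assms word_prod_closed[OF sub(2)] by (simp add: p_def)
  have p0: "p 0 = x" "p n = y" using assms ws(2) by (simp_all add: p_def n_def)
  have le: "wd (p i) (p j) \<le> real j - real i" if "i \<le> j" for i j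
  proof -
    have eq: "take j ws = take i ws @ take (j - i) (drop i ws)"
      using that by (metis le_add_diff_inverse take_add)
    have s: "set (take (j - i) (drop i ws)) \<subseteq> letters"
      using sub(3) set_take_subset by (meson order_trans)
    then have c: "set (take (j - i) (drop i ws)) \<subseteq> carrier G" using generators_closed(2) by blast
    have "word_prod (take j ws) = word_prod (take i ws) \<otimes> word_prod (take (j - i) (drop i ws))"
      unfolding eq by (rule word_prod_append[OF sub(2) c])
    then have "p j = p i \<otimes> word_prod (take (j - i) (drop i ws))"
      using assms word_prod_closed[OF sub(2)] word_prod_closed[OF c] by (simp add: p_def m_assoc)
    then have "inv (p i) \<otimes> p j = word_prod (take (j - i) (drop i ws))"
      using cl word_prod_closed[OF c] by (simp add: inv_solve_left')
    then have "wl (inv (p i) \<otimes> p j) \<le> j - i" by (intro wl_le[OF s]) auto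
    then show ?thesis using that by (simp add: wd_eq)
  qed
  have n: "wd (p 0) (p n) = real n" unfolding p0 using ws(3) by (simp add: wd_eq n_def)
  have eq: "wd (p i) (p j) = real j - real i" if "i \<le> j" "j \<le> n" for i j
    using le[of i j] le[of 0 i] le[of j n] wd_tri[of "p 0" "p i" "p n"] wd_tri[of "p i" "p j" "p n"] cl n that
    by simp
  have "wd (p i) (p j) = \<bar>real i - real j\<bar>" if "i \<le> n" "j \<le> n" for i j
    using eq[of i j] eq[of j i] wd_sym[OF cl[of i] cl[of j]] that by (cases "i \<le> j") auto
  then show thesis by (rule that[OF p0 cl])
qed

text \<open>Applied to the identity it compares the word metrics of two generating sets; applied to
  an automorphism and to its inverse it makes the automorphism bilipschitz.\<close>

lemma hom_lipschitz:
  assumes "f \<in> hom G G" and "finite_generating_set G S'"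
  obtains L where "L \<ge> 1" "\<And>x y. x \<in> carrier G \<Longrightarrow> y \<in> carrier G \<Longrightarrow>
    word_dist G S' (f x) (f y) \<le> L * wd x y"
proof -
  interpret S': generated_group G S' by standard (rule assms(2))
  interpret f: group_hom G G f by standard (rule assms(1))
  define m where "m = Max ((\<lambda>s. S'.wl (f s)) ` insert \<one> letters)"
  have "finite letters" using gen by (simp add: finite_generating_set_def)
  then have m: "S'.wl (f s) \<le> m" if "s \<in> letters" for s
    unfolding m_def using that by (intro Max_ge) auto
  have words: "S'.wl (f (word_prod ws)) \<le> m * length ws" if "set ws \<subseteq> letters" for ws
    using that
  proof (induction ws)
    case (Cons w ws)
    have c: "w \<in> carrier G" "word_prod ws \<in> carrier G"
      using order_trans[OF Cons.prems generators_closed(2)] word_prod_closed[of ws] by simp_all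
    have "S'.wl (f w \<otimes> f (word_prod ws)) \<le> S'.wl (f w) + S'.wl (f (word_prod ws))"
      using c by (intro S'.wl_mult) auto
    also have "\<dots> \<le> m + m * length ws" using Cons m[of w] by (intro add_mono) auto
    finally show ?case using c by simp
  qed simp
  have *: "real (S'.wl (f x)) \<le> real (m + 1) * real (wl x)" if "x \<in> carrier G" for x
  proof -
    obtain ws where ws: "set ws \<subseteq> letters" "word_prod ws = x" "length ws = wl x"
      using shortest_word[OF \<open>x \<in> carrier G\<close>] by metis
    have "S'.wl (f x) \<le> m * wl x" using words[OF ws(1)] ws by simp
    also have "\<dots> \<le> (m + 1) * wl x" by simp
    finally show ?thesis by (metis of_nat_le_iff of_nat_mult)
  qed
  show thesis
  proof
    show "real (m + 1) \<ge> 1" by simp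
    show "word_dist G S' (f x) (f y) \<le> real (m + 1) * wd x y" if "x \<in> carrier G" "y \<in> carrier G" for x y
      using *[of "inv x \<otimes> y"] that by (simp add: wd_eq S'.wd_eq)
  qed
qed

end

locale hyperbolic_metric_group = group G + hyperbolic_pseudometric d "carrier G" \<delta>
  for G (structure) and d \<delta> +
  assumes left_invariant:
      "g \<in> carrier G \<Longrightarrow> x \<in> carrier G \<Longrightarrow> y \<in> carrier G \<Longrightarrow> d (g \<otimes> x) (g \<otimes> y) = d x y"
    and finite_balls: "finite {x \<in> carrier G. d \<one> x \<le> r}"

text \<open>Precomposing the word metric with a retraction onto the group makes it a pseudometric on the
  whole type, so that the geometric lemmas above carry no membership conditions.\<close>

lemma hyperbolic_group_metric:
  assumes "group G" "hyperbolic_group G"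
  obtains d \<delta> S where "hyperbolic_metric_group G d \<delta>" "finite_generating_set G S"
    "\<And>x y. x \<in> carrier G \<Longrightarrow> y \<in> carrier G \<Longrightarrow> d x y = word_dist G S x y"
proof -
  obtain S where S: "finite_generating_set G S" "Gromov_hyperbolic (carrier G) (word_dist G S)"
    using assms(2) unfolding hyperbolic_group_def by blast
  interpret group G by (rule assms(1))
  interpret generated_group G S by standard (rule S(1))
  obtain \<delta> where \<delta>: "\<And>w x y z. w \<in> carrier G \<Longrightarrow> x \<in> carrier G \<Longrightarrow> y \<in> carrier G \<Longrightarrow> z \<in> carrier G \<Longrightarrow>
      Gromov_product wd w x z \<ge> min (Gromov_product wd w x y) (Gromov_product wd w y z) - \<delta>"
    using S(2) unfolding Gromov_hyperbolic_def by metis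
  define r where "r x = (if x \<in> carrier G then x else \<one>\<^bsub>G\<^esub>)" for x
  define d where "d x y = wd (r x) (r y)" for x y
  have r [simp]: "r x \<in> carrier G" "x \<in> carrier G \<Longrightarrow> r x = x" for x by (auto simp: r_def)
  have d: "d x y = wd x y" if "x \<in> carrier G" "y \<in> carrier G" for x y using that by (simp add: d_def)
  have gp: "Gromov_product d w x y = Gromov_product wd (r w) (r x) (r y)" for w x y
    by (simp add: Gromov_product_def d_def)
  have "hyperbolic_metric_group G d \<delta>"
  proof
    fix w x y z
    show "d x x = 0" "d x y = d y x" "d x z \<le> d x y + d y z"
      by (simp_all add: d_def wd_sym wd_tri)
    show "min (Gromov_product d w x y) (Gromov_product d w y z) - \<delta> \<le> Gromov_product d w x z"
      unfolding gp by (rule \<delta>) auto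
  next
    fix x y assume "x \<in> carrier G" "y \<in> carrier G"
    then show "\<exists>p n. p 0 = x \<and> p n = y \<and> (\<forall>i\<le>n. p i \<in> carrier G) \<and>
      (\<forall>i\<le>n. \<forall>j\<le>n. d (p i) (p j) = \<bar>real i - real j\<bar>)"
      by (rule wd_geodesic) (metis d)
  next
    fix g x y assume "g \<in> carrier G" "x \<in> carrier G" "y \<in> carrier G"
    then show "d (g \<otimes>\<^bsub>G\<^esub> x) (g \<otimes>\<^bsub>G\<^esub> y) = d x y" by (simp add: d wd_left_invariant)
  next
    fix b :: real
    have "{x \<in> carrier G. d \<one>\<^bsub>G\<^esub> x \<le> b} \<subseteq> {x \<in> carrier G. wl x \<le> nat \<lfloor>b\<rfloor>}"
      by (auto simp: d wd_eq) linarith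
    then show "finite {x \<in> carrier G. d \<one>\<^bsub>G\<^esub> x \<le> b}" by (rule finite_subset) (rule finite_ball_wl)
  qed
  then show thesis using S(1) d by (rule that)
qed

section \<open>Hyperbolic groups\<close>

context hyperbolic_metric_group
begin

lemma dist_one: "x \<in> carrier G \<Longrightarrow> y \<in> carrier G \<Longrightarrow> d \<one> (inv x \<otimes> y) = d x y"
  using left_invariant[of "inv x" x y] by simp

lemma dist_one_inv: "x \<in> carrier G \<Longrightarrow> d \<one> (inv x) = d \<one> x"
  using dist_one[of x \<one>] dist_sym by simp

lemma dist_right: "x \<in> carrier G \<Longrightarrow> y \<in> carrier G \<Longrightarrow> d x (x \<otimes> y) = d \<one> y"
  using left_invariant[of x \<one> y] by simp

lemma gp_left_invariant:
  "g \<in> carrier G \<Longrightarrow> w \<in> carrier G \<Longrightarrow> x \<in> carrier G \<Longrightarrow> y \<in> carrier G \<Longrightarrow>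
    gp (g \<otimes> w) (g \<otimes> x) (g \<otimes> y) = gp w x y"
  by (simp add: gp_def left_invariant)

lemma unbounded:
  assumes "infinite (carrier G)"
  obtains x where "x \<in> carrier G" "d \<one> x > r"
proof -
  have "\<not> carrier G \<subseteq> {x \<in> carrier G. d \<one> x \<le> r}"
    using assms finite_balls finite_subset by blast
  then obtain x where "x \<in> carrier G" "\<not> d \<one> x \<le> r" by blast
  then show thesis by (intro that) auto
qed

text \<open>Otherwise a long \<open>x\<close>, a much longer \<open>y\<close> and \<open>x \<otimes> y\<close> have short squares. Then \<open>x \<otimes> y\<close> is close
  to \<open>inv y \<otimes> inv x\<close> and hence points in the direction of \<open>y\<close>; but \<open>x\<close>, as seen from the identity,
  lies in the direction of exactly one of \<open>y\<close> and \<open>x \<otimes> y\<close>.\<close>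

lemma exists_long_square:
  assumes "infinite (carrier G)" and "R \<ge> 0"
    and col: "\<And>x y z. x \<in> carrier G \<Longrightarrow> y \<in> carrier G \<Longrightarrow> z \<in> carrier G \<Longrightarrow>
      gp x y z \<le> R \<or> gp y x z \<le> R \<or> gp z x y \<le> R"
  shows "\<exists>g\<in>carrier G. d \<one> g > 2 * R \<and> d \<one> (g \<otimes> g) > 4 * R"
proof (rule ccontr)
  assume no: "\<not> (\<exists>g\<in>carrier G. d \<one> g > 2 * R \<and> d \<one> (g \<otimes> g) > 4 * R)"
  define r where "r = 4 * R"
  have r: "d (inv g) g \<le> r" if "g \<in> carrier G" "d \<one> g > 2 * R" for g
    using that no dist_one[of "inv g" g] r_def by force
  obtain x where x: "x \<in> carrier G" "d \<one> x > 2 * R + r + \<delta>"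
    using unbounded[OF assms(1)] by blast
  define N where "N = d \<one> x"
  obtain y where y: "y \<in> carrier G" "d \<one> y > 3 * N + r + R + \<delta>"
    using unbounded[OF assms(1)] by blast
  define M where "M = d \<one> y"
  define z where "z = x \<otimes> y"
  have z: "z \<in> carrier G" "inv z = inv y \<otimes> inv x"
    using x y by (auto simp: z_def inv_mult_group)
  have N: "N > 2 * R + r + \<delta>" and M: "M > 3 * N + r + R + \<delta>" using x y by (auto simp: N_def M_def)
  have pos: "N \<ge> 0" "M \<ge> 0" "r \<ge> 0" using assms(2) by (auto simp: N_def M_def r_def)
  have dz: "d (inv x) y = d \<one> z" using dist_one[of "inv x" y] x y by (simp add: z_def)
  have xx: "d (inv x) x \<le> r" "d (inv y) y \<le> r"
    using r[OF x(1)] r[OF y(1)] N M pos delta_nonneg assms(2) unfolding N_def M_def by linarith+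
  have z1: "d \<one> z \<ge> M - N"
    using dz dist_tri[of \<one> y "inv x"] dist_one_inv[OF x(1)] by (simp add: N_def M_def)
  then have zz: "d (inv z) z \<le> r" using r[OF z(1)] N M pos delta_nonneg assms(2) by linarith
  have "d (inv y) (inv z) = N" using dist_right[of "inv y" "inv x"] dist_one_inv x y z by (simp add: N_def)
  then have yz: "d y z \<le> N + 2 * r"
    using dist_tri[of y z "inv y"] dist_tri[of "inv y" z "inv z"] xx zz dist_sym[of y "inv y"] by linarith
  have xz: "d x z = M" using dist_right[of x y] x y by (simp add: z_def M_def)
  have xy: "d \<one> z \<le> d x y + r" "d x y \<le> d \<one> z + r"
    using dz dist_tri[of "inv x" y x] dist_tri[of x y "inv x"] dist_sym[of x "inv x"] xx by linarith+
  have *: "gp \<one> x y = (N + M - d x y) / 2" "gp \<one> x z = (N + d \<one> z - M) / 2" "gp \<one> y z = (M + d \<one> z - d y z) / 2"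
    "gp x \<one> y = (N + d x y - M) / 2" "gp y \<one> x = (M + d x y - N) / 2"
    using xz dist_sym[of x \<one>] dist_sym[of y \<one>] dist_sym[of y x] by (simp_all add: gp_def N_def M_def)
  have h: "gp \<one> x y \<ge> min (gp \<one> x z) (gp \<one> y z) - \<delta>" "gp \<one> x z \<ge> min (gp \<one> x y) (gp \<one> y z) - \<delta>"
    using hyperbolic[of \<one> x z y] hyperbolic[of \<one> x y z] gp_sym by metis+
  \<comment> \<open>Since \<open>y\<close> is much longer than \<open>x\<close>, the product at
    \<open>y\<close> is large, and collinearity makes the product at \<open>\<one>\<close> or at
    \<open>x\<close> small. In the first case \<open>x\<close> points towards \<open>z\<close> but
    not \<open>y\<close>, in the second towards \<open>y\<close> but not \<open>z\<close>. Both
    contradict hyperbolicity, because \<open>y\<close> and \<open>z\<close> point in the same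
    direction.\<close>
  have "gp \<one> x y \<le> R \<or> gp x \<one> y \<le> R \<or> gp y \<one> x \<le> R" using col x y by simp
  moreover have "M \<le> N + d x y" using dist_tri[of \<one> y x] by (simp add: N_def M_def)
  then have "gp y \<one> x \<ge> M - N" unfolding *(5) by argo
  then have "gp y \<one> x > R" using M pos delta_nonneg by argo
  ultimately show False
    using h * xy z1 yz M N pos delta_nonneg assms(2) unfolding r_def by argo
qed

text \<open>The hypothesis says that every triple lies coarsely on a line. An element
  \<open>g\<close> with long square moves along this line, so multiplying a far element by
  \<open>g\<close> or its inverse brings it closer to \<open>\<one>\<close>. A shortest element of
  each coset of the subgroup generated by \<open>g\<close> then lies in a fixed ball, which bounds
  the index.\<close>

lemma collinear_virtually_cyclic:
  assumes inf: "infinite (carrier G)" and "R \<ge> 0"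
    and col: "\<And>x y z. x \<in> carrier G \<Longrightarrow> y \<in> carrier G \<Longrightarrow> z \<in> carrier G \<Longrightarrow>
      gp x y z \<le> R \<or> gp y x z \<le> R \<or> gp z x y \<le> R"
  shows "virtually_cyclic G"
proof -
  obtain g where g: "g \<in> carrier G" "d \<one> g > 2 * R" "d \<one> (g \<otimes> g) > 4 * R"
    using exists_long_square[OF inf \<open>R \<ge> 0\<close> col] by blast
  define N where "N = d \<one> g"
  define g' where "g' = inv g"
  have g': "g' \<in> carrier G" "d \<one> g' = N" "d g' g > 4 * R"
    using g dist_one_inv dist_one[of "inv g" g] by (auto simp: g'_def N_def)
  \<comment> \<open>If neither \<open>g\<close> nor \<open>g'\<close> were closer to
    \<open>x\<close> than \<open>\<one>\<close> is, collinearity would put \<open>\<one>\<close>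
    between \<open>x\<close> and each of them. All three products of the triple \<open>x\<close>,
    \<open>g\<close>, \<open>g'\<close> would then exceed \<open>R\<close>; the bound
    \<open>4 * R\<close> on the square of \<open>g\<close> is what makes the products at
    \<open>g\<close> and \<open>g'\<close> do so.\<close>
  have shorten: "d g x < d \<one> x \<or> d g' x < d \<one> x" if x: "x \<in> carrier G" "d \<one> x > 2 * N" for x
  proof (rule ccontr)
    assume "\<not> ?thesis"
    then have far: "d g x \<ge> d \<one> x" "d g' x \<ge> d \<one> x" by auto
    have N: "N > 2 * R" using g by (simp add: N_def)
    have *: "gp \<one> g x = (N + d \<one> x - d g x) / 2" "gp g \<one> x = (N + d g x - d \<one> x) / 2"
       "gp x \<one> g = (d \<one> x + d g x - N) / 2"
       "gp \<one> g' x = (N + d \<one> x - d g' x) / 2" "gp g' \<one> x = (N + d g' x - d \<one> x) / 2"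
       "gp x \<one> g' = (d \<one> x + d g' x - N) / 2"
       "gp x g g' = (d g x + d g' x - d g' g) / 2" "gp g x g' = (d g x + d g' g - d g' x) / 2"
       "gp g' x g = (d g' x + d g' g - d g x) / 2"
      using g' dist_sym by (auto simp: gp_def N_def)
    have "gp \<one> g x \<le> R \<or> gp g \<one> x \<le> R \<or> gp x \<one> g \<le> R"
      "gp \<one> g' x \<le> R \<or> gp g' \<one> x \<le> R \<or> gp x \<one> g' \<le> R"
      using col g(1) g'(1) x(1) by simp_all
    then have "gp \<one> g x \<le> R" "gp \<one> g' x \<le> R"
      using * far N x(2) assms(2) by argo+
    moreover have "gp x g g' \<le> R \<or> gp g x g' \<le> R \<or> gp g' x g \<le> R" using col x g g' by simp
    moreover have "d g' g \<le> 2 * N" using dist_tri[of g' g \<one>] dist_sym[of g' \<one>] g' N_def by simp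
    ultimately show False using * far N x(2) g'(3) assms(2) dist_tri[of g x \<one>] dist_tri[of g' x \<one>]
       dist_sym[of g \<one>] dist_sym[of g' \<one>] g'(2) N_def by argo
  qed
  define K where "K = carrier (subgroup_generated G {g})"
  have K: "subgroup K G" unfolding K_def by (rule subgroup_subgroup_generated)
  have "cyclic_group (subgroup_generated G K)"
  proof -
    have "generate G (carrier G \<inter> K) = generate G (carrier G \<inter> {g})"
      using subgroup.carrier_subgroup_generated_subgroup[OF K] K_def by (simp flip: carrier_subgroup_generated)
    then have "subgroup_generated G K = subgroup_generated G {g}" by (simp add: subgroup_generated_def)
    then show ?thesis using cyclic_group_generated[of g] by simp
  qed
  have gK: "g \<in> K" "g' \<in> K"
  proof -
    show "g \<in> K" unfolding K_def using g by (auto simp: carrier_subgroup_generated generate.incl)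
    then show "g' \<in> K" unfolding g'_def using subgroup.m_inv_closed[OF K] by simp
  qed
  have "\<exists>b\<in>{x \<in> carrier G. d \<one> x \<le> 2 * N}. K #> x = K #> b" if x: "x \<in> carrier G" for x
  proof -
    define A where "A = {z \<in> K #> x. d \<one> z \<le> d \<one> x}"
    have Kx: "K #> x \<subseteq> carrier G" using K x by (simp add: r_coset_subset_G subgroup.subset)
    then have "A \<subseteq> {z \<in> carrier G. d \<one> z \<le> d \<one> x}" by (auto simp: A_def)
    then have fin: "finite A" using finite_balls finite_subset by blast
    have ne: "A \<noteq> {}" using rcos_self[OF x K] by (auto simp: A_def)
    define b where "b = arg_min_on (d \<one>) A"
    have bA: "b \<in> A" unfolding b_def using fin ne by (rule arg_min_if_finite)
    have bmin: "d \<one> b \<le> d \<one> z" if "z \<in> A" for z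
      using arg_min_if_finite(2)[OF fin ne, of "d \<one>"] that unfolding b_def by (meson not_less)
    have b: "b \<in> K #> x" "b \<in> carrier G" using bA Kx by (auto simp: A_def)
    have mem: "k \<otimes> b \<in> K #> x" if "k \<in> K" for k
      using b(1) that subgroup.mem_carrier[OF K] x K unfolding r_coset_def
      by (auto simp: m_assoc[symmetric] intro: subgroup.m_closed)
    have "d \<one> b \<le> 2 * N"
    proof (rule ccontr)
      assume "\<not> ?thesis"
      then consider "d g b < d \<one> b" | "d g' b < d \<one> b" using shorten[of b] b by auto
      then show False
      proof cases
        case 1
        have "d \<one> (g' \<otimes> b) = d g b" using dist_one g b by (simp add: g'_def)
        then show False using 1 mem[OF gK(2)] bmin[of "g' \<otimes> b"] bA by (auto simp: A_def)
      next
        case 2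
        have "d \<one> (g \<otimes> b) = d g' b" using dist_one[of g' b] g b by (simp add: g'_def)
        then show False using 2 mem[OF gK(1)] bmin[of "g \<otimes> b"] bA by (auto simp: A_def)
      qed
    qed
    moreover have "K #> x = K #> b" using repr_independence[OF b(1) x K] by simp
    ultimately show ?thesis using b by blast
  qed
  then have "rcosets\<^bsub>G\<^esub> K \<subseteq> (\<lambda>b. K #> b) ` {x \<in> carrier G. d \<one> x \<le> 2 * N}"
    unfolding RCOSETS_def by blast
  then have "finite (rcosets\<^bsub>G\<^esub> K)" using finite_balls by (meson finite_surj)
  then show ?thesis
    using K \<open>cyclic_group (subgroup_generated G K)\<close> unfolding virtually_cyclic_def by blast
qed

text \<open>What matters is that \<open>K\<close> does not depend on \<open>R\<close>: this is a
  finite substitute for three distinct points at infinity. If it failed for some \<open>R\<close>,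
  translating the quasi-center of any triple to \<open>\<one>\<close> would show that one of the
  three points is close to the quasi-center, so every triple would be collinear.\<close>

lemma three_directions:
  assumes "non_elementary G"
  obtains K where "K \<ge> 0" "\<And>R. \<exists>p\<in>carrier G. \<exists>q\<in>carrier G. \<exists>r\<in>carrier G.
    R \<le> d \<one> p \<and> R \<le> d \<one> q \<and> R \<le> d \<one> r \<and> gp \<one> p q \<le> K \<and> gp \<one> p r \<le> K \<and> gp \<one> q r \<le> K"
proof -
  define K where "K = \<delta> + 1"
  have "\<exists>p\<in>carrier G. \<exists>q\<in>carrier G. \<exists>r\<in>carrier G.
    R \<le> d \<one> p \<and> R \<le> d \<one> q \<and> R \<le> d \<one> r \<and> gp \<one> p q \<le> K \<and> gp \<one> p r \<le> K \<and> gp \<one> q r \<le> K" for R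
  proof (rule ccontr)
    assume neg: "\<not> ?thesis"
    define R' where "R' = max 0 R + K"
    have R': "R' \<ge> 0" "R + K \<le> R'" using delta_nonneg by (auto simp: R'_def K_def)
    have "gp x y z \<le> R' \<or> gp y x z \<le> R' \<or> gp z x y \<le> R'"
      if xyz: "x \<in> carrier G" "y \<in> carrier G" "z \<in> carrier G" for x y z
    proof -
      obtain c where c: "c \<in> carrier G" "gp c x y \<le> K" "gp c x z \<le> K" "gp c y z \<le> K"
        using quasi_center_exists[OF xyz(1,2)] K_def by blast
      have t: "d \<one> (inv c \<otimes> u) = d c u" if "u \<in> carrier G" for u using dist_one c that by simp
      have u: "gp \<one> (inv c \<otimes> u) (inv c \<otimes> v) = gp c u v" if "u \<in> carrier G" "v \<in> carrier G" for u v
        using gp_left_invariant[of "inv c" c u v] c that by simp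
      have "\<not> (R \<le> d c x \<and> R \<le> d c y \<and> R \<le> d c z)"
      proof
        assume "R \<le> d c x \<and> R \<le> d c y \<and> R \<le> d c z"
        then show False
          using neg c t u xyz by (metis inv_closed m_closed)
      qed
      moreover have "gp x y z \<le> K + d c x" "gp y x z \<le> K + d c y" "gp z x y \<le> K + d c z"
        using gp_change_base[of x y z c] gp_change_base[of y x z c] gp_change_base[of z x y c] c
          dist_sym[of c] by simp_all
      ultimately show ?thesis using R' by argo
    qed
    then have "virtually_cyclic G"
      using assms R' by (intro collinear_virtually_cyclic[of R']) (auto simp: non_elementary_def)
    then show False using assms by (simp add: non_elementary_def)
  qed
  moreover have "K \<ge> 0" using delta_nonneg by (simp add: K_def)
  ultimately show thesis by (intro that)
qed

text \<open>An element of bounded displacement fixes three directions at infinity, and so moves their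
  quasi-center \<open>\<one>\<close> a bounded amount.\<close>

lemma bounded_displacement_trivial:
  assumes "non_elementary G" "trivial_finite_radical G"
    and "b \<in> carrier G" "\<And>y. y \<in> carrier G \<Longrightarrow> d y (b \<otimes> y) \<le> R"
  shows "b = \<one>"
proof -
  obtain K where K: "K \<ge> 0" "\<And>R. \<exists>p\<in>carrier G. \<exists>q\<in>carrier G. \<exists>r\<in>carrier G.
    R \<le> d \<one> p \<and> R \<le> d \<one> q \<and> R \<le> d \<one> r \<and> gp \<one> p q \<le> K \<and> gp \<one> p r \<le> K \<and> gp \<one> q r \<le> K"
    using three_directions[OF assms(1)] by metis
  \<comment> \<open>The displacement bound may vary with the element, so that closure under products
    and conjugation is immediate. Finiteness comes from the uniform estimate that follows.\<close>
  define N where "N = {b \<in> carrier G. \<exists>R. \<forall>y\<in>carrier G. d y (b \<otimes> y) \<le> R}"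
  have "d \<one> b \<le> 2 * K + 4 * \<delta>" if "b \<in> N" for b
  proof -
    obtain R where b: "b \<in> carrier G" and R: "\<And>y. y \<in> carrier G \<Longrightarrow> d y (b \<otimes> y) \<le> R"
      using \<open>b \<in> N\<close> N_def by blast
    obtain p q r where pqr: "p \<in> carrier G" "q \<in> carrier G" "r \<in> carrier G"
      and far: "R + K + 2 * \<delta> + 1 \<le> d \<one> p" "R + K + 2 * \<delta> + 1 \<le> d \<one> q" "R + K + 2 * \<delta> + 1 \<le> d \<one> r"
      and gp: "gp \<one> p q \<le> K" "gp \<one> p r \<le> K" "gp \<one> q r \<le> K"
      using K(2) by blast
    have close: "gp b u (b \<otimes> u) \<ge> K + 2 * \<delta> + 1" if "u \<in> carrier G" "R + K + 2 * \<delta> + 1 \<le> d \<one> u" for u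
      using gp_ge_dist[of b "b \<otimes> u" u] R[OF that(1)] dist_right[OF b that(1)] that(2)
        gp_sym[of b u] dist_sym[of u] by simp
    \<comment> \<open>By left invariance the translates of \<open>u\<close> and \<open>v\<close> by
      \<open>b\<close> have product at most \<open>K\<close> at \<open>b\<close>. The products of
      \<open>u\<close> and \<open>v\<close> with their own translates are too large to be the
      minimum in \<open>gp_min3\<close>, so the remaining one is bounded.\<close>
    have "gp b u v \<le> K + 2 * \<delta>"
      if "u \<in> carrier G" "v \<in> carrier G" "R + K + 2 * \<delta> + 1 \<le> d \<one> u" "R + K + 2 * \<delta> + 1 \<le> d \<one> v"
        "gp \<one> u v \<le> K" for u v
      using gp_min3[of b "b \<otimes> u" u v "b \<otimes> v"] gp_left_invariant[of b \<one> u v] close[of u] close[of v]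
        b that gp_sym[of b u] by simp
    then have "gp b p q \<le> K + 2 * \<delta>" "gp b p r \<le> K + 2 * \<delta>" "gp b q r \<le> K + 2 * \<delta>"
      using pqr far gp by blast+
    then show ?thesis using quasi_centers_close[OF gp] by fastforce
  qed
  then have "N \<subseteq> {x \<in> carrier G. d \<one> x \<le> 2 * K + 4 * \<delta>}" by (auto simp: N_def)
  then have "finite N" using finite_balls finite_subset by blast
  have "subgroup N G"
  proof (rule subgroupI)
    show "N \<subseteq> carrier G" by (auto simp: N_def)
    show "N \<noteq> {}" using one_closed by (auto simp: N_def intro!: exI[of _ \<one>] exI[of _ 0])
  next
    fix a assume "a \<in> N"
    then obtain R where a: "a \<in> carrier G" "\<And>y. y \<in> carrier G \<Longrightarrow> d y (a \<otimes> y) \<le> R" by (auto simp: N_def)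
    have "d y (inv a \<otimes> y) \<le> R" if "y \<in> carrier G" for y
      using a(2)[of "inv a \<otimes> y"] a that dist_sym[of y] by simp
    then show "inv a \<in> N" using a by (auto simp: N_def)
  next
    fix a b assume "a \<in> N" "b \<in> N"
    then obtain R R' where a: "a \<in> carrier G" "\<And>y. y \<in> carrier G \<Longrightarrow> d y (a \<otimes> y) \<le> R"
      and b: "b \<in> carrier G" "\<And>y. y \<in> carrier G \<Longrightarrow> d y (b \<otimes> y) \<le> R'" by (auto simp: N_def)
    have "d y (a \<otimes> b \<otimes> y) \<le> R + R'" if "y \<in> carrier G" for y
    proof -
      have "d (b \<otimes> y) (a \<otimes> (b \<otimes> y)) \<le> R" using a b that by simp
      then show ?thesis
        unfolding m_assoc[OF a(1) b(1) that]
        using b(2)[OF that] dist_tri[of y "a \<otimes> (b \<otimes> y)" "b \<otimes> y"] by linarith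
    qed
    then show "a \<otimes> b \<in> N" using a b by (auto simp: N_def)
  qed
  moreover have "x \<otimes> a \<otimes> inv x \<in> N" if x: "x \<in> carrier G" and "a \<in> N" for x a
  proof -
    obtain R where a: "a \<in> carrier G" "\<And>y. y \<in> carrier G \<Longrightarrow> d y (a \<otimes> y) \<le> R"
      using \<open>a \<in> N\<close> by (auto simp: N_def)
    have "d y (x \<otimes> a \<otimes> inv x \<otimes> y) \<le> R" if "y \<in> carrier G" for y
      using a(2)[of "inv x \<otimes> y"] left_invariant[of x "inv x \<otimes> y" "a \<otimes> (inv x \<otimes> y)"] a x that
      by (simp add: m_assoc)
    then show ?thesis using a x by (auto simp: N_def)
  qed
  ultimately have "N \<lhd> G" by (simp add: normal_inv_iff)
  then have "N = {\<one>}" using \<open>finite N\<close> assms(2) by (simp add: trivial_finite_radical_def)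
  moreover have "b \<in> N" using assms(3,4) by (auto simp: N_def)
  ultimately show ?thesis by simp
qed

text \<open>After a pigeonhole argument \<open>c \<otimes> \<phi> y\<close> is uniformly close to \<open>y\<close> for a fixed \<open>c\<close>, and
  the cocycle identity for \<open>\<beta> y = inv y \<otimes> c \<otimes> \<phi> y\<close> turns this into bounded displacement of
  \<open>\<beta> x \<otimes> inv c\<close>.\<close>

lemma automorphism_trivial:
  assumes "non_elementary G" "trivial_finite_radical G" and hom: "\<phi> \<in> hom G G"
    and balls: "\<And>n::nat. \<exists>x\<in>carrier G. \<forall>y\<in>carrier G. d \<one> y \<le> real n \<longrightarrow> d (x \<otimes> y) (\<phi> (x \<otimes> y)) \<le> C"
    and "z \<in> carrier G"
  shows "\<phi> z = z"
proof -
  interpret \<phi>: group_hom G G \<phi> by standard (rule hom)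
  obtain x where x: "\<And>n::nat. x n \<in> carrier G"
    "\<And>n y. y \<in> carrier G \<Longrightarrow> d \<one> y \<le> real n \<Longrightarrow> d (x n \<otimes> y) (\<phi> (x n \<otimes> y)) \<le> C"
    using balls by metis
  define c where "c n = inv (x n) \<otimes> \<phi> (x n)" for n
  have c_cl: "c n \<in> carrier G" for n using x by (simp add: c_def)
  have eq: "inv (x n \<otimes> y) \<otimes> \<phi> (x n \<otimes> y) = inv y \<otimes> c n \<otimes> \<phi> y" if "y \<in> carrier G" for n y
    using that x(1) by (simp add: c_def inv_mult_group m_assoc)
  have c_bd: "d \<one> (inv y \<otimes> c n \<otimes> \<phi> y) \<le> C" if "y \<in> carrier G" "d \<one> y \<le> real n" for n y
    using x(2)[OF that] dist_one[of "x n \<otimes> y" "\<phi> (x n \<otimes> y)"] that x(1)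
    by (metis eq m_closed \<phi>.hom_closed)
  have "range c \<subseteq> {x \<in> carrier G. d \<one> x \<le> C}"
    using c_bd[of \<one>] c_cl by auto
  then have "finite (range c)" using finite_balls finite_subset by blast
  \<comment> \<open>One value of \<open>c\<close> occurs for infinitely many \<open>n\<close>, hence
    for balls of arbitrarily large radius, and the bound \<open>C\<close> then holds for that value
    at every \<open>y\<close>.\<close>
  then obtain k where inf: "infinite {n. c n = c k}"
    using pigeonhole_infinite[of UNIV c] by auto
  define a where "a = c k"
  have a: "a \<in> carrier G" using c_cl a_def by simp
  define \<beta> where "\<beta> y = inv y \<otimes> a \<otimes> \<phi> y" for y
  have \<beta>_cl: "\<beta> y \<in> carrier G" if "y \<in> carrier G" for y using that a by (simp add: \<beta>_def)
  have \<beta>_bd: "d \<one> (\<beta> y) \<le> C" if y: "y \<in> carrier G" for y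
  proof -
    obtain n where "n > nat \<lceil>d \<one> y\<rceil>" "c n = a"
      using inf unfolding infinite_nat_iff_unbounded a_def by blast
    then show ?thesis using c_bd[OF y, of n] unfolding \<beta>_def by (simp add: nat_less_iff) linarith
  qed
  have \<beta>: "\<beta> u = a" if u: "u \<in> carrier G" for u
  proof -
    have bd: "d y (\<beta> u \<otimes> inv a \<otimes> y) \<le> 2 * C" if y: "y \<in> carrier G" for y
    proof -
      have "inv y \<otimes> (\<beta> u \<otimes> inv a \<otimes> y) = \<beta> (u \<otimes> y) \<otimes> inv (\<beta> y)"
        using u y a by (simp add: \<beta>_def m_assoc inv_mult_group)
      then have "d y (\<beta> u \<otimes> inv a \<otimes> y) = d \<one> (\<beta> (u \<otimes> y) \<otimes> inv (\<beta> y))"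
        using dist_one[of y "\<beta> u \<otimes> inv a \<otimes> y"] u y a \<beta>_cl by simp
      also have "\<dots> \<le> d \<one> (\<beta> (u \<otimes> y)) + d \<one> (inv (\<beta> y))"
        using dist_tri[of \<one> "\<beta> (u \<otimes> y) \<otimes> inv (\<beta> y)" "\<beta> (u \<otimes> y)"] dist_right[of "\<beta> (u \<otimes> y)" "inv (\<beta> y)"] u y \<beta>_cl
        by simp
      also have "\<dots> \<le> 2 * C" using \<beta>_bd[of y] \<beta>_bd[of "u \<otimes> y"] u y dist_one_inv[OF \<beta>_cl[OF y]] by simp
      finally show ?thesis .
    qed
    have "\<beta> u \<otimes> inv a = \<one>"
      by (rule bounded_displacement_trivial[OF assms(1,2) _ bd]) (use u a \<beta>_cl in auto)
    then show ?thesis using u a \<beta>_cl by (metis inv_closed inv_equality inv_inv)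
  qed
  have conj: "\<phi> u = inv a \<otimes> u \<otimes> a" if "u \<in> carrier G" for u
  proof -
    have "u \<otimes> (inv u \<otimes> a \<otimes> \<phi> u) = u \<otimes> a" using \<beta>[OF that] by (simp add: \<beta>_def)
    then have "a \<otimes> \<phi> u = u \<otimes> a" using that a by (simp add: m_assoc)
    then have "inv a \<otimes> (a \<otimes> \<phi> u) = inv a \<otimes> (u \<otimes> a)" by simp
    then show ?thesis using that a by (simp add: m_assoc)
  qed
  \<comment> \<open>By construction \<open>a\<close> is \<open>inv (x k)\<close> times the image of
    \<open>x k\<close>. Inserting the conjugation formula for this image makes one factor
    \<open>a\<close> cancel and leaves a conjugate of \<open>inv a\<close> equal to
    \<open>\<one>\<close>.\<close>
  have "inv (x k) \<otimes> (inv a \<otimes> x k \<otimes> a) = a" using conj[OF x(1)] a_def c_def by metis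
  then have "inv (x k) \<otimes> (inv a \<otimes> x k) \<otimes> a = a" using a x(1) by (simp add: m_assoc)
  then have "inv (x k) \<otimes> (inv a \<otimes> x k) = \<one>" using a x(1) by (simp add: r_cancel_one)
  then have "inv a \<otimes> x k = x k" using a x(1) by (metis inv_mult_cancel(1) m_closed inv_closed r_one)
  then have "inv a = \<one>" using a x(1) by (simp add: r_cancel_one)
  then show ?thesis using conj[OF assms(5)] a assms(5) by (metis inv_inv inv_one l_one r_one)
qed

end

section \<open>Geodesic rays\<close>

text \<open>Nested infinite index sets are chosen on which longer and longer prefixes are constant.
  Stating the limit through infinite sets of indices that agree up to \<open>k\<close> avoids naming
  a subsequence.\<close>

lemma diagonal_limit:
  fixes f :: "nat \<Rightarrow> nat \<Rightarrow> 'a"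
  assumes "\<And>k. finite (range (\<lambda>n. f n k))"
  obtains g where "\<And>k. infinite {n. \<forall>i\<le>k. f n i = g i}"
proof -
  define P where "P k A \<longleftrightarrow> infinite A \<and> (\<forall>i<k. \<forall>m\<in>A. \<forall>n\<in>A. f m i = f n i)" for k :: nat and A
  have "\<exists>A. \<forall>k. P k (A k) \<and> A (Suc k) \<subseteq> A k"
  proof (rule dependent_nat_choice)
    show "\<exists>A. P 0 A" unfolding P_def by (intro exI[of _ UNIV]) auto
  next
    fix A k assume A: "P k A"
    have "finite ((\<lambda>n. f n k) ` A)" using assms[of k] by (rule rev_finite_subset) auto
    moreover have A: "infinite A" "\<And>i m n. i < k \<Longrightarrow> m \<in> A \<Longrightarrow> n \<in> A \<Longrightarrow> f m i = f n i"
      using A unfolding P_def by blast+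
    ultimately obtain m where m: "infinite {n \<in> A. f n k = f m k}"
      using pigeonhole_infinite[of A "\<lambda>n. f n k"] by blast
    have "f a i = f b i" if "i < Suc k" "a \<in> A" "f a k = f m k" "b \<in> A" "f b k = f m k" for a b i
    proof (cases "i = k")
      case False
      then show ?thesis using that by (intro A(2)) auto
    qed (simp add: that)
    with m have "P (Suc k) {n \<in> A. f n k = f m k}" unfolding P_def by blast
    then show "\<exists>B. P (Suc k) B \<and> B \<subseteq> A" by (intro exI[of _ "{n \<in> A. f n k = f m k}"]) simp
  qed
  then obtain A where A: "\<And>k. P k (A k)" "\<And>k. A (Suc k) \<subseteq> A k" by blast
  define g where "g i = f (SOME n. n \<in> A (Suc i)) i" for i
  have eq: "f n i = g i" if "n \<in> A (Suc i)" for n i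
  proof -
    have "(SOME n. n \<in> A (Suc i)) \<in> A (Suc i)" using that by (rule someI)
    then show ?thesis using A(1)[of "Suc i"] that lessI unfolding P_def g_def by blast
  qed
  have "infinite {n. \<forall>i\<le>k. f n i = g i}" for k
  proof -
    have "A (Suc k) \<subseteq> A (Suc i)" if "i \<le> k" for i
      using lift_Suc_antimono_le[of A "Suc i" "Suc k"] A(2) that by simp
    then have "A (Suc k) \<subseteq> {n. \<forall>i\<le>k. f n i = g i}" using eq by blast
    moreover have "infinite (A (Suc k))" using A(1) unfolding P_def by blast
    ultimately show ?thesis using finite_subset by blast
  qed
  then show thesis by (rule that)
qed

context generated_group
begin

abbreviation ray :: "(nat \<Rightarrow> 'a) \<Rightarrow> bool" where "ray \<equiv> geodesic_ray G S"
abbreviation based_ray :: "(nat \<Rightarrow> 'a) \<Rightarrow> bool" where "based_ray \<eta> \<equiv> ray \<eta> \<and> \<eta> 0 = \<one>"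
abbreviation fhd :: "'a set \<Rightarrow> 'a set \<Rightarrow> bool" where "fhd \<equiv> finite_Hausdorff_dist wd"

lemma ray_closed: "ray \<eta> \<Longrightarrow> \<eta> i \<in> carrier G"
  by (auto simp: geodesic_ray_def)

lemma ray_dist: "ray \<eta> \<Longrightarrow> wd (\<eta> i) (\<eta> j) = \<bar>real i - real j\<bar>"
  by (auto simp: geodesic_ray_def)

lemma fhd_refl: "A \<subseteq> carrier G \<Longrightarrow> fhd A A"
  unfolding finite_Hausdorff_dist_def using wd_refl by (intro exI[of _ 0] conjI ballI bexI) auto

lemma fhd_sym:
  assumes "A \<subseteq> carrier G" "B \<subseteq> carrier G" "fhd A B"
  shows "fhd B A"
proof -
  obtain C where C: "\<forall>a\<in>A. \<exists>b\<in>B. wd a b \<le> C" "\<forall>b\<in>B. \<exists>a\<in>A. wd a b \<le> C"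
    using assms(3) unfolding finite_Hausdorff_dist_def by blast
  have "wd a b = wd b a" if "a \<in> A" "b \<in> B" for a b using wd_sym assms(1,2) that by blast
  then show ?thesis unfolding finite_Hausdorff_dist_def using C by (intro exI[of _ C]) metis
qed

lemma fhd_trans:
  assumes "A \<subseteq> carrier G" "B \<subseteq> carrier G" "C \<subseteq> carrier G" "fhd A B" "fhd B C"
  shows "fhd A C"
proof -
  obtain r where r: "\<forall>a\<in>A. \<exists>b\<in>B. wd a b \<le> r" "\<forall>b\<in>B. \<exists>a\<in>A. wd a b \<le> r"
    using assms(4) unfolding finite_Hausdorff_dist_def by blast
  obtain s where s: "\<forall>a\<in>B. \<exists>b\<in>C. wd a b \<le> s" "\<forall>b\<in>C. \<exists>a\<in>B. wd a b \<le> s"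
    using assms(5) unfolding finite_Hausdorff_dist_def by blast
  have tri: "wd a c \<le> r + s" if "a \<in> A" "b \<in> B" "c \<in> C" "wd a b \<le> r" "wd b c \<le> s" for a b c
  proof -
    have "a \<in> carrier G" "b \<in> carrier G" "c \<in> carrier G" using assms(1-3) that by blast+
    then show ?thesis using wd_tri[of a b c] that by linarith
  qed
  have "\<exists>c\<in>C. wd a c \<le> r + s" if a: "a \<in> A" for a
  proof -
    obtain b where b: "b \<in> B" "wd a b \<le> r" using r(1) a by blast
    obtain c where c: "c \<in> C" "wd b c \<le> s" using s(1) b by blast
    show ?thesis using tri[OF a b(1) c(1) b(2) c(2)] c(1) by blast
  qed
  moreover have "\<exists>a\<in>A. wd a c \<le> r + s" if c: "c \<in> C" for c
  proof -
    obtain b where b: "b \<in> B" "wd b c \<le> s" using s(2) c by blast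
    obtain a where a: "a \<in> A" "wd a b \<le> r" using r(2) b by blast
    show ?thesis using tri[OF a(1) b(1) c a(2) b(2)] a(1) by blast
  qed
  ultimately show ?thesis unfolding finite_Hausdorff_dist_def by blast
qed

lemma ray_class_self: "ray \<eta> \<Longrightarrow> \<eta> \<in> ray_class G S \<eta>"
  unfolding ray_class_def using fhd_refl by (auto simp: geodesic_ray_def)

lemma ray_class_eqI:
  assumes "ray \<eta>" "ray \<gamma>" "fhd (range \<eta>) (range \<gamma>)"
  shows "ray_class G S \<eta> = ray_class G S \<gamma>"
proof -
  have c: "range \<zeta> \<subseteq> carrier G" if "ray \<zeta>" for \<zeta> using that by (simp add: geodesic_ray_def)
  have sub: "ray_class G S \<gamma> \<subseteq> ray_class G S \<eta>" if r: "ray \<eta>" "ray \<gamma>" "fhd (range \<eta>) (range \<gamma>)" for \<eta> \<gamma>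
  proof
    fix \<zeta> assume "\<zeta> \<in> ray_class G S \<gamma>"
    then have \<zeta>: "ray \<zeta>" "fhd (range \<gamma>) (range \<zeta>)" by (simp_all add: ray_class_def)
    then have "fhd (range \<eta>) (range \<zeta>)" using fhd_trans[OF c[OF r(1)] c[OF r(2)] c[OF \<zeta>(1)] r(3)] by blast
    then show "\<zeta> \<in> ray_class G S \<eta>" using \<zeta>(1) by (simp add: ray_class_def)
  qed
  have "fhd (range \<gamma>) (range \<eta>)" by (rule fhd_sym[OF c[OF assms(1)] c[OF assms(2)] assms(3)])
  then show ?thesis using sub[OF assms] sub[OF assms(2,1)] by blast
qed

text \<open>For \<open>n\<close> at least \<open>k\<close> the entry \<open>f n k\<close> lies in a
  ball, which is finite; the finitely many earlier \<open>n\<close>, where \<open>f n\<close> need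
  not be geodesic up to \<open>k\<close>, add finitely many values. Hence
  \<open>diagonal_limit\<close> applies.\<close>

lemma limit_geodesic:
  assumes "\<And>n. f n 0 = \<one>" "\<And>n i. f n i \<in> carrier G"
    and geo: "\<And>n i j. i \<le> n \<Longrightarrow> j \<le> n \<Longrightarrow> wd (f n i) (f n j) = \<bar>real i - real j\<bar>"
  obtains \<eta> where "based_ray \<eta>" "\<And>k. infinite {n. \<forall>i\<le>k. f n i = \<eta> i}"
proof -
  have "finite (range (\<lambda>n. f n k))" for k
  proof -
    have ball: "f n k \<in> {x \<in> carrier G. wl x \<le> k}" if "k \<le> n" for n
      using geo[of 0 n k] that assms(1,2) by (simp add: wd_eq)
    then have "range (\<lambda>n. f n k) \<subseteq> {x \<in> carrier G. wl x \<le> k} \<union> (\<lambda>n. f n k) ` {..<k}"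
    proof (intro subsetI)
      fix x assume "x \<in> range (\<lambda>n. f n k)"
      then obtain n where "x = f n k" by blast
      then show "x \<in> {x \<in> carrier G. wl x \<le> k} \<union> (\<lambda>n. f n k) ` {..<k}"
        by (cases "k \<le> n") (metis UnI1 ball, metis UnI2 imageI lessThan_iff not_le)
    qed
    moreover have "finite ({x \<in> carrier G. wl x \<le> k} \<union> (\<lambda>n. f n k) ` {..<k})"
      using finite_ball_wl by simp
    ultimately show ?thesis by (rule finite_subset)
  qed
  then obtain \<eta> where \<eta>: "\<And>k. infinite {n. \<forall>i\<le>k. f n i = \<eta> i}"
    using diagonal_limit[of f] by metis
  have agree: "\<exists>n\<ge>k. \<forall>i\<le>k. f n i = \<eta> i" for k
    using \<eta>[of k] unfolding infinite_nat_iff_unbounded_le by blast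
  have cl: "\<eta> i \<in> carrier G" for i
  proof -
    obtain n where "\<forall>l\<le>i. f n l = \<eta> l" using agree by blast
    then show ?thesis using assms(2)[of n i] by simp
  qed
  have dist: "wd (\<eta> i) (\<eta> j) = \<bar>real i - real j\<bar>" for i j
  proof -
    obtain n where "n \<ge> max i j" "\<forall>l\<le>max i j. f n l = \<eta> l" using agree by blast
    then show ?thesis using geo[of i n j] by simp
  qed
  obtain n where "\<forall>l\<le>0. f n l = \<eta> l" using agree by blast
  then have "\<eta> 0 = \<one>" using assms(1)[of n] by simp
  then have "based_ray \<eta>" using cl dist by (simp add: geodesic_ray_def image_subset_iff)
  then show thesis using \<eta> by (rule that[of \<eta>])
qed

end

text \<open>\<open>L\<close> compares the two metrics, \<open>D\<close> and \<open>C\<close> are the constants of the Morse lemma for the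
  geodesics of the word metric, and \<open>K\<close> bounds the Gromov products of three directions.\<close>

locale boundary_setting = hyperbolic_metric_group G d \<delta> + generated_group G S
  for G (structure) and d \<delta> S +
  fixes L D C K :: real
  assumes L_ge_1: "L \<ge> 1" and D_nonneg: "D \<ge> 0" and K_nonneg: "K \<ge> 0"
    and comparable: "x \<in> carrier G \<Longrightarrow> y \<in> carrier G \<Longrightarrow> d x y \<le> L * wd x y"
      "x \<in> carrier G \<Longrightarrow> y \<in> carrier G \<Longrightarrow> wd x y \<le> L * d x y"
    and Morse: "bilip L c n \<Longrightarrow> k \<le> n \<Longrightarrow> gp (c k) (c 0) (c n) \<le> D"
    and near_path: "bilip L c n \<Longrightarrow> gp z (c 0) (c n) \<le> B \<Longrightarrow> \<exists>i\<le>n. d z (c i) \<le> 2 * B + C"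
    and directions: "\<exists>p\<in>carrier G. \<exists>q\<in>carrier G. \<exists>r\<in>carrier G.
      R \<le> d \<one> p \<and> R \<le> d \<one> q \<and> R \<le> d \<one> r \<and> gp \<one> p q \<le> K \<and> gp \<one> p r \<le> K \<and> gp \<one> q r \<le> K"
begin

lemma geodesic_bilip:
  assumes "\<And>i. i \<le> n \<Longrightarrow> c i \<in> carrier G"
    "\<And>i j. i \<le> n \<Longrightarrow> j \<le> n \<Longrightarrow> wd (c i) (c j) = \<bar>real i - real j\<bar>"
  shows "bilip L c n"
proof -
  have "d (c i) (c j) \<le> L * \<bar>real i - real j\<bar> \<and> \<bar>real i - real j\<bar> \<le> L * d (c i) (c j)"
    if "i \<le> n" "j \<le> n" for i j
    using comparable[of "c i" "c j"] assms that by simp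
  then show ?thesis using assms(1) by (simp add: bilip_def)
qed

lemma ray_bilip: "ray \<eta> \<Longrightarrow> bilip L \<eta> n"
  by (intro geodesic_bilip) (auto simp: ray_closed ray_dist)

lemma ray_dist_le: "ray \<eta> \<Longrightarrow> d (\<eta> i) (\<eta> j) \<le> L * \<bar>real i - real j\<bar>"
  using comparable(1)[of "\<eta> i" "\<eta> j"] by (simp add: ray_closed ray_dist)

lemma ray_dist_ge: "ray \<eta> \<Longrightarrow> \<bar>real i - real j\<bar> \<le> L * d (\<eta> i) (\<eta> j)"
  using comparable(2)[of "\<eta> i" "\<eta> j"] by (simp add: ray_closed ray_dist)

lemma based_ray_unbounded:
  assumes "based_ray \<eta>"
  obtains T where "\<And>t. t \<ge> T \<Longrightarrow> d \<one> (\<eta> t) \<ge> B"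
proof
  fix t assume "t \<ge> nat \<lceil>L * B\<rceil>"
  then have "L * B \<le> real t" by linarith
  then have "L * B \<le> L * d \<one> (\<eta> t)" using ray_dist_ge[of \<eta> 0 t] assms by simp
  then show "d \<one> (\<eta> t) \<ge> B" using L_ge_1 by simp
qed

lemma ray_gp_ge:
  assumes "ray \<eta>" "s \<le> t"
  shows "gp \<one> (\<eta> s) (\<eta> t) \<ge> d \<one> (\<eta> s) - D - d \<one> (\<eta> 0)"
proof -
  have "gp (\<eta> s) (\<eta> 0) (\<eta> t) \<le> D" using Morse[OF ray_bilip] assms by simp
  then have "gp (\<eta> s) \<one> (\<eta> t) \<le> D + d \<one> (\<eta> 0)"
    using gp_change_arg[of "\<eta> s" \<one> "\<eta> t" "\<eta> 0"] by simp
  then show ?thesis using gp_add[of \<one> "\<eta> s" "\<eta> t"] by linarith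
qed

text \<open>The ray is a limit of word geodesics from \<open>\<one>\<close> to the points
  \<open>x n\<close>. The growth \<open>L * real n\<close> ensures that the \<open>n\<close>-th
  geodesic has at least \<open>n\<close> steps, and \<open>Morse\<close> puts each
  \<open>\<eta> k\<close> coarsely between \<open>\<one>\<close> and some late
  \<open>x n\<close>.\<close>

lemma limit_ray:
  assumes x: "\<And>n. x n \<in> carrier G" "\<And>n. L * real n \<le> d \<one> (x n)"
  obtains \<eta> where "based_ray \<eta>" "\<And>k. \<exists>n\<ge>k. gp (\<eta> k) \<one> (x n) \<le> D"
proof -
  have "\<exists>p m. p 0 = \<one> \<and> p m = x n \<and> (\<forall>i. p i \<in> carrier G) \<and>
    (\<forall>i\<le>m. \<forall>j\<le>m. wd (p i) (p j) = \<bar>real i - real j\<bar>)" for n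
    using wd_geodesic[of \<one> "x n"] x by (metis one_closed)
  then obtain p m where p: "\<And>n. p n 0 = \<one>" "\<And>n. p n (m n) = x n" "\<And>n i. p n i \<in> carrier G"
    "\<And>n i j. i \<le> m n \<Longrightarrow> j \<le> m n \<Longrightarrow> wd (p n i) (p n j) = \<bar>real i - real j\<bar>"
    by metis
  have mn: "n \<le> m n" for n
  proof -
    have "d \<one> (x n) \<le> L * real (m n)" using comparable(1)[of \<one> "x n"] p(4)[of 0 n "m n"] p(1,2) x by simp
    then have "L * real n \<le> L * real (m n)" using x(2)[of n] by linarith
    then show ?thesis using L_ge_1 by simp
  qed
  have geo: "wd (p n i) (p n j) = \<bar>real i - real j\<bar>" if "i \<le> n" "j \<le> n" for n i j
    using p(4)[of i n j] mn[of n] that by simp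
  obtain \<eta> where \<eta>: "based_ray \<eta>" "\<And>k. infinite {n. \<forall>i\<le>k. p n i = \<eta> i}"
    using limit_geodesic[of p, OF p(1,3) geo] by blast
  have "\<exists>n\<ge>k. gp (\<eta> k) \<one> (x n) \<le> D" for k
  proof -
    obtain n where n: "n \<ge> k" "p n k = \<eta> k"
      using \<eta>(2)[of k] unfolding infinite_nat_iff_unbounded_le by blast
    have "bilip L (p n) (m n)" using p(3,4) by (intro geodesic_bilip) auto
    then have "gp (p n k) (p n 0) (p n (m n)) \<le> D" using Morse n(1) mn[of n] by simp
    then show ?thesis using n p by auto
  qed
  then show thesis by (rule that[OF \<eta>(1)])
qed

section \<open>Rays that pass near a given element and fork there\<close>

lemma two_behind:
  assumes "y \<in> carrier G"
  shows "\<exists>p\<in>carrier G. \<exists>q\<in>carrier G. R \<le> d y p \<and> R \<le> d y q \<and> gp y p q \<le> K \<and>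
    gp y \<one> p \<le> K + \<delta> \<and> gp y \<one> q \<le> K + \<delta>"
proof -
  obtain p q r where pqr: "p \<in> carrier G" "q \<in> carrier G" "r \<in> carrier G"
    "R \<le> d \<one> p" "R \<le> d \<one> q" "R \<le> d \<one> r" "gp \<one> p q \<le> K" "gp \<one> p r \<le> K" "gp \<one> q r \<le> K"
    using directions by blast
  have gp: "gp y (y \<otimes> u) (y \<otimes> v) = gp \<one> u v" if "u \<in> carrier G" "v \<in> carrier G" for u v
    using gp_left_invariant[of y \<one> u v] that assms by simp
  \<comment> \<open>After translation to \<open>y\<close> the three directions are separated at
    \<open>y\<close>, so \<open>\<one>\<close> can lie in at most one of them. The other two lead
    away from \<open>\<one>\<close> beyond \<open>y\<close>.\<close>
  have m: "min (gp y \<one> (y \<otimes> u)) (gp y \<one> (y \<otimes> v)) \<le> K + \<delta>"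
    if "u \<in> carrier G" "v \<in> carrier G" "gp \<one> u v \<le> K" for u v
    using hyperbolic[of y "y \<otimes> u" \<one> "y \<otimes> v"] gp[OF that(1,2)] that(3) gp_sym[of y \<one> "y \<otimes> u"] by linarith
  have "gp y \<one> (y \<otimes> p) \<le> K + \<delta> \<and> gp y \<one> (y \<otimes> q) \<le> K + \<delta> \<or>
    gp y \<one> (y \<otimes> p) \<le> K + \<delta> \<and> gp y \<one> (y \<otimes> r) \<le> K + \<delta> \<or>
    gp y \<one> (y \<otimes> q) \<le> K + \<delta> \<and> gp y \<one> (y \<otimes> r) \<le> K + \<delta>"
    using m[of p q] m[of p r] m[of q r] pqr by linarith
  moreover have "y \<otimes> u \<in> carrier G" "d y (y \<otimes> u) = d \<one> u" if "u \<in> carrier G" for u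
    using that assms dist_right by auto
  ultimately show ?thesis using gp pqr by metis
qed

text \<open>There are no dead ends: \<open>two_behind\<close> gives arbitrarily far points for which
  \<open>p\<close> is coarsely on the way from \<open>\<one>\<close>, and the limit ray inherits
  this at the price of one more \<delta>.\<close>

lemma ray_through:
  assumes p: "p \<in> carrier G"
  obtains \<eta> T where "based_ray \<eta>" "\<And>t. t \<ge> T \<Longrightarrow> gp p \<one> (\<eta> t) \<le> K + 2 * \<delta>"
proof -
  have "\<exists>x\<in>carrier G. L * real n \<le> d \<one> x \<and> gp p \<one> x \<le> K + \<delta>" for n
  proof -
    obtain x where "x \<in> carrier G" "L * real n + d \<one> p \<le> d p x" "gp p \<one> x \<le> K + \<delta>"
      using two_behind[OF p] by blast
    then show ?thesis using dist_tri[of p x \<one>] dist_sym[of p \<one>] by force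
  qed
  then obtain x where x: "\<And>n. x n \<in> carrier G" "\<And>n. L * real n \<le> d \<one> (x n)"
    "\<And>n. gp p \<one> (x n) \<le> K + \<delta>" by metis
  obtain \<eta> where \<eta>: "based_ray \<eta>" "\<And>k. \<exists>n\<ge>k. gp (\<eta> k) \<one> (x n) \<le> D"
    using limit_ray[OF x(1,2)] by blast
  obtain T where T: "\<And>t. t \<ge> T \<Longrightarrow> d \<one> (\<eta> t) \<ge> d \<one> p + D"
    using based_ray_unbounded[OF \<eta>(1)] by blast
  have "gp p \<one> (\<eta> t) \<le> K + 2 * \<delta>" if "t \<ge> T" for t
  proof -
    obtain n where n: "gp (\<eta> t) \<one> (x n) \<le> D" using \<eta>(2) by blast
    have "gp \<one> (\<eta> t) (x n) \<ge> d \<one> p" using n gp_add[of \<one> "\<eta> t" "x n"] T[OF that] by linarith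
    moreover have "gp \<one> p (x n) \<ge> d \<one> p - K - \<delta>" using gp_add[of \<one> p "x n"] x(3)[of n] by linarith
    ultimately have "gp \<one> p (\<eta> t) \<ge> d \<one> p - K - 2 * \<delta>"
      using hyperbolic[of \<one> p "x n" "\<eta> t"] gp_sym[of \<one> "\<eta> t"] delta_nonneg K_nonneg by (smt (verit))
    then show ?thesis using gp_add[of \<one> p "\<eta> t"] by linarith
  qed
  with \<eta>(1) show thesis by (rule that[of \<eta> T])
qed

text \<open>The rays are led through two separated points \<open>p\<close> and \<open>q\<close>
  behind \<open>y\<close>. With these at distance \<open>R\<close> from \<open>y\<close>, each ray
  still points from \<open>y\<close> towards its own guide, so the separation of \<open>p\<close>
  and \<open>q\<close> passes to the rays.\<close>

lemma two_rays:
  assumes y: "y \<in> carrier G"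
  obtains \<eta> \<zeta> T where "based_ray \<eta>" "based_ray \<zeta>"
    "\<And>s t. s \<ge> T \<Longrightarrow> t \<ge> T \<Longrightarrow> gp y (\<eta> s) (\<zeta> t) \<le> K + 2 * \<delta>"
    "\<And>t. t \<ge> T \<Longrightarrow> gp y \<one> (\<eta> t) \<le> K + 2 * \<delta>" "\<And>t. t \<ge> T \<Longrightarrow> gp y \<one> (\<zeta> t) \<le> K + 2 * \<delta>"
proof -
  define R where "R = 2 * K + 10 * \<delta> + 1"
  obtain p q where pq: "p \<in> carrier G" "q \<in> carrier G" "R \<le> d y p" "R \<le> d y q"
    "gp y p q \<le> K" "gp y \<one> p \<le> K + \<delta>" "gp y \<one> q \<le> K + \<delta>"
    using two_behind[OF y] by blast
  have *: "gp y u v > K + 3 * \<delta> \<and> gp y \<one> v \<le> K + 2 * \<delta>"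
    if "R \<le> d y u" "gp y \<one> u \<le> K + \<delta>" "gp u \<one> v \<le> K + 2 * \<delta>" for u v
  proof -
    have "gp u \<one> y \<ge> R - K - \<delta>" using gp_add[of y u \<one>] that gp_sym[of y u \<one>] gp_sym[of u y \<one>] by linarith
    then have "gp u y v \<le> K + 3 * \<delta>"
      using hyperbolic[of u \<one> y v] that delta_nonneg K_nonneg unfolding R_def by linarith
    then have "gp y u v \<ge> R - K - 3 * \<delta>" using gp_add[of y u v] that by linarith
    then have 1: "gp y u v > K + 3 * \<delta>" unfolding R_def using delta_nonneg K_nonneg by linarith
    moreover have "gp y \<one> v \<le> K + 2 * \<delta>"
      using hyperbolic[of y \<one> v u] that 1 gp_sym[of y v u] delta_nonneg K_nonneg by linarith
    ultimately show ?thesis by blast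
  qed
  obtain \<eta> T where \<eta>: "based_ray \<eta>" "\<And>t. t \<ge> T \<Longrightarrow> gp p \<one> (\<eta> t) \<le> K + 2 * \<delta>"
    using ray_through[OF pq(1)] by blast
  obtain \<zeta> T' where \<zeta>: "based_ray \<zeta>" "\<And>t. t \<ge> T' \<Longrightarrow> gp q \<one> (\<zeta> t) \<le> K + 2 * \<delta>"
    using ray_through[OF pq(2)] by blast
  have "gp y (\<eta> s) (\<zeta> t) \<le> K + 2 * \<delta>" if "s \<ge> T" "t \<ge> T'" for s t
    using *[OF pq(3,6) \<eta>(2)[OF that(1)]] *[OF pq(4,7) \<zeta>(2)[OF that(2)]] pq(5)
      gp_min3[of y p "\<eta> s" "\<zeta> t" q] gp_sym[of y q "\<zeta> t"] delta_nonneg by linarith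
  then show thesis
    using that[of \<eta> \<zeta> "max T T'"] \<eta> \<zeta> *[OF pq(3,6)] *[OF pq(4,7)] by simp
qed

section \<open>Equality of boundary points and representatives starting at the identity\<close>

lemma asymptotic_near:
  assumes "ray \<eta>" "ray \<gamma>" and unb: "\<And>B. \<exists>s t. gp \<one> (\<eta> s) (\<gamma> t) \<ge> B"
  shows "\<exists>E. \<forall>k. \<exists>j. d (\<eta> k) (\<gamma> j) \<le> E"
proof -
  define e where "e = d \<one> (\<eta> 0)"
  define e' where "e' = d \<one> (\<gamma> 0)"
  have "\<exists>j. d (\<eta> k) (\<gamma> j) \<le> 2 * (D + e + \<delta> + e') + C" for k
  proof -
    have len: "d \<one> (\<eta> i) \<le> e + L * real i" for i
      using dist_tri[of \<one> "\<eta> i" "\<eta> 0"] ray_dist_le[OF assms(1), of 0 i] by (simp add: e_def)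
    \<comment> \<open>The bound exceeds the distance from \<open>\<one>\<close> to
      \<open>\<eta> i\<close> for every \<open>i\<close> up to \<open>k\<close>, so \<open>s\<close>
      lies beyond \<open>k\<close> and \<open>\<gamma>\<close> is followed past
      \<open>\<eta> k\<close>.\<close>
    obtain s t where st: "gp \<one> (\<eta> s) (\<gamma> t) \<ge> e + L * real k + 1" using unb by blast
    have "k \<le> s"
    proof (rule ccontr)
      assume "\<not> k \<le> s"
      then have "L * real s \<le> L * real k" using L_ge_1 by simp
      then show False using st len[of s] gp_le_dist(1)[of \<one> "\<eta> s" "\<gamma> t"] by linarith
    qed
    then have "gp \<one> (\<eta> k) (\<eta> s) \<ge> d \<one> (\<eta> k) - D - e" using ray_gp_ge[OF assms(1)] e_def by blast
    then have "gp \<one> (\<eta> k) (\<gamma> t) \<ge> d \<one> (\<eta> k) - D - e - \<delta>"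
      using hyperbolic[of \<one> "\<eta> k" "\<eta> s" "\<gamma> t"] st len[of k] D_nonneg dist_nonneg[of \<one> "\<eta> 0"] e_def by linarith
    then have "gp (\<eta> k) \<one> (\<gamma> t) \<le> D + e + \<delta>" using gp_add[of \<one> "\<eta> k" "\<gamma> t"] by linarith
    then have "gp (\<eta> k) (\<gamma> 0) (\<gamma> t) \<le> D + e + \<delta> + e'"
      using gp_change_arg[of "\<eta> k" "\<gamma> 0" "\<gamma> t" \<one>] dist_sym[of \<one> "\<gamma> 0"] e'_def by linarith
    then show ?thesis using near_path[OF ray_bilip[OF assms(2)]] by blast
  qed
  then show ?thesis by blast
qed

lemma asymptotic_ray_class:
  assumes \<eta>: "ray \<eta>" and \<gamma>: "ray \<gamma>" and unb: "\<And>B. \<exists>s t. gp \<one> (\<eta> s) (\<gamma> t) \<ge> B"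
  shows "ray_class G S \<eta> = ray_class G S \<gamma>"
proof (rule ray_class_eqI[OF \<eta> \<gamma>])
  obtain E where E: "\<And>k. \<exists>j. d (\<eta> k) (\<gamma> j) \<le> E"
    using asymptotic_near[OF assms] by auto
  have "\<exists>s t. gp \<one> (\<gamma> s) (\<eta> t) \<ge> B" for B
  proof -
    obtain s t where "gp \<one> (\<eta> s) (\<gamma> t) \<ge> B" using unb by blast
    then show ?thesis using gp_sym[of \<one> "\<eta> s" "\<gamma> t"] by auto
  qed
  then obtain E' where E': "\<And>k. \<exists>j. d (\<gamma> k) (\<eta> j) \<le> E'"
    using asymptotic_near[OF \<gamma> \<eta>] by auto
  have le: "wd (\<eta> i) (\<gamma> j) \<le> L * max E E'" if "d (\<eta> i) (\<gamma> j) \<le> max E E'" for i j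
  proof -
    have "L * d (\<eta> i) (\<gamma> j) \<le> L * max E E'" using that L_ge_1 by (intro mult_left_mono) auto
    then show ?thesis using comparable(2)[OF ray_closed[OF \<eta>] ray_closed[OF \<gamma>], of i j] by linarith
  qed
  have 1: "\<exists>j. wd (\<eta> i) (\<gamma> j) \<le> L * max E E'" for i
  proof -
    obtain j where "d (\<eta> i) (\<gamma> j) \<le> E" using E by blast
    then have "d (\<eta> i) (\<gamma> j) \<le> max E E'" by linarith
    then show ?thesis using le[of i j] by blast
  qed
  have 2: "\<exists>i. wd (\<eta> i) (\<gamma> j) \<le> L * max E E'" for j
  proof -
    obtain i where "d (\<gamma> j) (\<eta> i) \<le> E'" using E' by blast
    then have "d (\<eta> i) (\<gamma> j) \<le> max E E'" using dist_sym[of "\<gamma> j" "\<eta> i"] by linarith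
    then show ?thesis using le[of i j] by blast
  qed
  have "\<exists>b\<in>range \<gamma>. wd a b \<le> L * max E E'" if "a \<in> range \<eta>" for a
    using 1 that by fast
  moreover have "\<exists>a\<in>range \<eta>. wd a b \<le> L * max E E'" if "b \<in> range \<gamma>" for b
    using 2 that by fast
  ultimately show "fhd (range \<eta>) (range \<gamma>)"
    unfolding finite_Hausdorff_dist_def by (intro exI conjI ballI)
qed

text \<open>Boundary points are classes of arbitrary rays, whereas the topology is a quotient of the
  based rays only. A limit of geodesics from \<open>\<one>\<close> to far points of
  \<open>\<gamma>\<close> links the two.\<close>

lemma based_representative:
  assumes "ray \<gamma>"
  obtains \<eta> where "based_ray \<eta>" "ray_class G S \<eta> = ray_class G S \<gamma>"
proof -
  have "\<exists>j. L * real n \<le> d \<one> (\<gamma> j)" for n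
  proof -
    define j where "j = nat \<lceil>L * (L * real n + d \<one> (\<gamma> 0))\<rceil>"
    have "L * (L * real n + d \<one> (\<gamma> 0)) \<le> L * d (\<gamma> 0) (\<gamma> j)"
    proof -
      have "L * (L * real n + d \<one> (\<gamma> 0)) \<le> real j" unfolding j_def by (rule real_nat_ceiling_ge)
      moreover have "real j \<le> L * d (\<gamma> 0) (\<gamma> j)" using ray_dist_ge[OF assms, of 0 j] by simp
      ultimately show ?thesis by (rule order_trans)
    qed
    then have "L * real n + d \<one> (\<gamma> 0) \<le> d (\<gamma> 0) (\<gamma> j)"
      by (rule mult_left_le_imp_le) (use L_ge_1 in simp)
    then show ?thesis using dist_tri[of "\<gamma> 0" "\<gamma> j" \<one>] dist_sym[of "\<gamma> 0" \<one>] by (intro exI[of _ j]) linarith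
  qed
  then obtain j where j: "\<And>n. L * real n \<le> d \<one> (\<gamma> (j n))" by metis
  obtain \<eta> where \<eta>: "based_ray \<eta>" "\<And>k. \<exists>n\<ge>k. gp (\<eta> k) \<one> (\<gamma> (j n)) \<le> D"
    using limit_ray[of "\<lambda>n. \<gamma> (j n)"] j ray_closed[OF assms] by blast
  have "\<exists>s t. gp \<one> (\<eta> s) (\<gamma> t) \<ge> B" for B
  proof -
    obtain k where k: "d \<one> (\<eta> k) \<ge> B + D" using based_ray_unbounded[OF \<eta>(1)] by blast
    obtain n where "gp (\<eta> k) \<one> (\<gamma> (j n)) \<le> D" using \<eta>(2) by blast
    then have "gp \<one> (\<eta> k) (\<gamma> (j n)) \<ge> B" using gp_add[of \<one> "\<eta> k" "\<gamma> (j n)"] k by linarith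
    then show ?thesis by blast
  qed
  then have "ray_class G S \<eta> = ray_class G S \<gamma>"
    by (intro asymptotic_ray_class) (use \<eta>(1) assms in auto)
  with \<eta>(1) show thesis by (rule that[of \<eta>])
qed

end

section \<open>Automorphisms fixing an open set of boundary points\<close>

context generated_group
begin

lemma topspace_based_rays: "\<eta> \<in> topspace (based_rays G S) \<longleftrightarrow> based_ray \<eta>"
  by (auto simp: based_rays_def geodesic_ray_def)

lemma openin_based_rays_cylinder:
  assumes "openin (based_rays G S) V" "\<eta> \<in> V"
  obtains k where "\<And>\<zeta>. based_ray \<zeta> \<Longrightarrow> (\<And>i. i \<le> k \<Longrightarrow> \<zeta> i = \<eta> i) \<Longrightarrow> \<zeta> \<in> V"
proof -
  obtain T where T: "openin (product_topology (\<lambda>_. discrete_topology (carrier G)) (UNIV :: nat set)) T"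
    "V = T \<inter> {\<gamma>. based_ray \<gamma>}"
    using assms(1) unfolding based_rays_def openin_subtopology by blast
  obtain U where U: "finite {i. U i \<noteq> carrier G}" "\<eta> \<in> Pi\<^sub>E UNIV U" "Pi\<^sub>E UNIV U \<subseteq> T"
  proof -
    have "\<eta> \<in> T" using assms(2) T(2) by blast
    then have "\<exists>U. finite {i \<in> UNIV. U i \<noteq> topspace (discrete_topology (carrier G))} \<and>
        \<eta> \<in> Pi\<^sub>E UNIV U \<and> Pi\<^sub>E UNIV U \<subseteq> T"
      using T(1) unfolding openin_product_topology_alt by blast
    then show thesis using that by auto
  qed
  obtain k where k: "\<And>i. U i \<noteq> carrier G \<Longrightarrow> i \<le> k"
    using U(1) unfolding finite_nat_set_iff_bounded_le by blast
  show thesis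
  proof (rule that[of k])
    fix \<zeta> assume \<zeta>: "based_ray \<zeta>" "\<And>i. i \<le> k \<Longrightarrow> \<zeta> i = \<eta> i"
    have "\<zeta> i \<in> U i" for i
    proof (cases "i \<le> k")
      case True
      then show ?thesis using \<zeta>(2) U(2) by auto
    next
      case False
      then have "U i = carrier G" using k by blast
      then show ?thesis using ray_closed \<zeta>(1) by blast
    qed
    then have "\<zeta> \<in> T" using U(3) by (auto simp: subset_iff)
    then show "\<zeta> \<in> V" using T(2) \<zeta>(1) by blast
  qed
qed

lemma fhd_image:
  assumes "A \<subseteq> carrier G" "B \<subseteq> carrier G" "fhd A B" "m \<ge> 0"
    and "\<And>x y. x \<in> carrier G \<Longrightarrow> y \<in> carrier G \<Longrightarrow> wd (f x) (f y) \<le> m * wd x y"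
  shows "fhd (f ` A) (f ` B)"
proof -
  obtain r where r: "\<forall>a\<in>A. \<exists>b\<in>B. wd a b \<le> r" "\<forall>b\<in>B. \<exists>a\<in>A. wd a b \<le> r"
    using assms(3) unfolding finite_Hausdorff_dist_def by blast
  have le: "wd (f a) (f b) \<le> m * r" if "a \<in> A" "b \<in> B" "wd a b \<le> r" for a b
  proof -
    have "wd (f a) (f b) \<le> m * wd a b" using assms(1,2,5) that by blast
    also have "\<dots> \<le> m * r" using that assms(4) by (intro mult_left_mono)
    finally show ?thesis .
  qed
  have "\<exists>b\<in>f ` B. wd a b \<le> m * r" if fa: "a \<in> f ` A" for a
  proof -
    obtain a' where a: "a' \<in> A" "a = f a'" using fa by blast
    obtain b where "b \<in> B" "wd a' b \<le> r" using r(1) a(1) by blast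
    then show ?thesis using le[OF a(1)] a(2) by blast
  qed
  moreover have "\<exists>a\<in>f ` A. wd a b \<le> m * r" if fb: "b \<in> f ` B" for b
  proof -
    obtain b' where b: "b' \<in> B" "b = f b'" using fb by blast
    obtain a where "a \<in> A" "wd a b' \<le> r" using r(2) b(1) by blast
    then show ?thesis using le[OF _ b(1)] b(2) by blast
  qed
  ultimately show ?thesis unfolding finite_Hausdorff_dist_def by (intro exI conjI ballI)
qed

end

context boundary_setting
begin

text \<open>Otherwise based rays \<open>h n\<close> with classes outside \<open>U\<close> would have
  products with \<open>\<gamma>\<close> tending to infinity. A limit of them is asymptotic to
  \<open>\<gamma>\<close>, though it may be a different ray of the same class. Since the whole
  preimage of \<open>U\<close> is open, it contains a cylinder around the limit and hence some
  \<open>h n\<close>.\<close>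

lemma nearby_rays_open:
  assumes U: "openin (boundary_topology G S) U" and \<gamma>: "based_ray \<gamma>" "ray_class G S \<gamma> \<in> U"
  obtains N where "\<And>\<eta> s t. based_ray \<eta> \<Longrightarrow> gp \<one> (\<eta> s) (\<gamma> t) \<ge> N \<Longrightarrow> ray_class G S \<eta> \<in> U"
proof -
  have "\<exists>N. \<forall>\<eta> s t. based_ray \<eta> \<longrightarrow> gp \<one> (\<eta> s) (\<gamma> t) \<ge> N \<longrightarrow> ray_class G S \<eta> \<in> U"
  proof (rule ccontr)
    assume "\<not> ?thesis"
    then have "\<forall>N. \<exists>\<eta> s t. based_ray \<eta> \<and> gp \<one> (\<eta> s) (\<gamma> t) \<ge> N \<and> ray_class G S \<eta> \<notin> U"
      by blast
    then have "\<forall>n::nat. \<exists>\<eta> s t. based_ray \<eta> \<and> gp \<one> (\<eta> s) (\<gamma> t) \<ge> real n \<and> ray_class G S \<eta> \<notin> U"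
      by blast
    then obtain h s t where h: "\<And>n::nat. based_ray (h n)" "\<And>n. gp \<one> (h n (s n)) (\<gamma> (t n)) \<ge> real n"
      "\<And>n. ray_class G S (h n) \<notin> U"
      by metis
    obtain \<eta> where \<eta>: "based_ray \<eta>" and inf: "\<And>k. infinite {n. \<forall>i\<le>k. h n i = \<eta> i}"
    proof (rule limit_geodesic[of h])
      show "h n 0 = \<one>" for n using h(1) by blast
      show "h n i \<in> carrier G" for n i using h(1) ray_closed by blast
      show "wd (h n i) (h n j) = \<bar>real i - real j\<bar>" for n i j using h(1) ray_dist by blast
    qed blast
    have agree: "\<exists>n\<ge>m. \<forall>i\<le>k. h n i = \<eta> i" for k m
      using inf[of k] unfolding infinite_nat_iff_unbounded_le by blast
    have "\<exists>s t. gp \<one> (\<eta> s) (\<gamma> t) \<ge> B" for B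
    proof -
      obtain k where k: "d \<one> (\<eta> k) \<ge> B + D + \<delta>" using based_ray_unbounded[OF \<eta>] by blast
      obtain n where n: "n \<ge> nat \<lceil>max (L * real k + 1) (B + \<delta>)\<rceil>" "h n k = \<eta> k" using agree by blast
      have n': "real n \<ge> L * real k + 1" "real n \<ge> B + \<delta>" using n(1) by linarith+
      have "k \<le> s n"
      proof (rule ccontr)
        assume "\<not> k \<le> s n"
        then have "L * real (s n) \<le> L * real k" using L_ge_1 by simp
        moreover have "d \<one> (h n (s n)) \<le> L * real (s n)"
          using ray_dist_le[of "h n" 0 "s n"] h(1)[of n] by simp
        ultimately show False
          using h(2)[of n] gp_le_dist(1)[of \<one> "h n (s n)" "\<gamma> (t n)"] n' by linarith
      qed
      then have "gp \<one> (h n k) (h n (s n)) \<ge> d \<one> (h n k) - D"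
        using ray_gp_ge[of "h n" k "s n"] h(1)[of n] by simp
      then have "gp \<one> (\<eta> k) (\<gamma> (t n)) \<ge> B"
        using hyperbolic[of \<one> "h n k" "h n (s n)" "\<gamma> (t n)"] h(2)[of n] n' n(2) k by simp
      then show ?thesis by blast
    qed
    then have "ray_class G S \<eta> = ray_class G S \<gamma>"
      by (intro asymptotic_ray_class) (use \<eta> \<gamma> in auto)
    then have "\<eta> \<in> {\<gamma> \<in> topspace (based_rays G S). ray_class G S \<gamma> \<in> U}"
      using \<eta> \<gamma>(2) topspace_based_rays by simp
    moreover have "openin (based_rays G S) {\<gamma> \<in> topspace (based_rays G S). ray_class G S \<gamma> \<in> U}"
      using U openin_boundary_topology by blast
    ultimately obtain k where k: "\<And>\<zeta>. based_ray \<zeta> \<Longrightarrow> (\<And>i. i \<le> k \<Longrightarrow> \<zeta> i = \<eta> i) \<Longrightarrow>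
        \<zeta> \<in> {\<gamma> \<in> topspace (based_rays G S). ray_class G S \<gamma> \<in> U}"
      using openin_based_rays_cylinder by metis
    obtain n where "\<forall>i\<le>k. h n i = \<eta> i" using agree by blast
    then have "h n \<in> {\<gamma> \<in> topspace (based_rays G S). ray_class G S \<gamma> \<in> U}"
      using k[OF h(1)[of n]] by blast
    then show False using h(3) by blast
  qed
  then show thesis using that by metis
qed

end

text \<open>The geometry sees an automorphism only as a bilipschitz self-map that fixes
  \<open>\<one>\<close>; the homomorphism law enters in \<open>automorphism_trivial\<close>.\<close>

locale boundary_action = boundary_setting +
  fixes f :: "'a \<Rightarrow> 'a" and \<mu> :: real
  assumes f_closed: "x \<in> carrier G \<Longrightarrow> f x \<in> carrier G" and f_one: "f \<one> = \<one>" and mu_ge_1: "\<mu> \<ge> 1"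
    and f_bilip: "x \<in> carrier G \<Longrightarrow> y \<in> carrier G \<Longrightarrow> d (f x) (f y) \<le> \<mu> * d x y \<and> d x y \<le> \<mu> * d (f x) (f y)"
begin

text \<open>\<open>boundary_map\<close> is a union over all representatives, so a fixed class only
  provides some \<open>\<gamma>\<close> asymptotic to \<open>\<eta>\<close> whose image is near
  \<open>\<eta>\<close>. The Lipschitz bound for \<open>f\<close> replaces \<open>\<gamma>\<close>
  by \<open>\<eta>\<close> itself.\<close>

lemma fixed_point_fhd:
  assumes \<eta>: "ray \<eta>" and fixed: "boundary_map G S f (ray_class G S \<eta>) = ray_class G S \<eta>"
  shows "fhd (range (f \<circ> \<eta>)) (range \<eta>)"
proof -
  have "\<eta> \<in> boundary_map G S f (ray_class G S \<eta>)" using fixed ray_class_self[OF \<eta>] by simp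
  then obtain \<gamma> where \<gamma>: "ray \<gamma>" "fhd (range \<eta>) (range \<gamma>)" "fhd (range (f \<circ> \<gamma>)) (range \<eta>)"
    unfolding boundary_map_def ray_class_def by blast
  have cl: "range \<eta> \<subseteq> carrier G" "range \<gamma> \<subseteq> carrier G" "range (f \<circ> \<eta>) \<subseteq> carrier G" "range (f \<circ> \<gamma>) \<subseteq> carrier G"
    using ray_closed \<eta> \<gamma>(1) f_closed by auto
  have "wd (f x) (f y) \<le> (L * (\<mu> * L)) * wd x y" if "x \<in> carrier G" "y \<in> carrier G" for x y
  proof -
    have "wd (f x) (f y) \<le> L * d (f x) (f y)" using comparable(2) f_closed that by simp
    also have "\<dots> \<le> L * (\<mu> * d x y)" using f_bilip that L_ge_1 by (intro mult_left_mono) auto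
    also have "\<dots> \<le> L * (\<mu> * (L * wd x y))"
      using comparable(1) that L_ge_1 mu_ge_1 by (intro mult_left_mono) auto
    finally show ?thesis by (simp add: mult.assoc)
  qed
  then have "fhd (f ` range \<eta>) (f ` range \<gamma>)"
    using L_ge_1 mu_ge_1 by (intro fhd_image[OF cl(1,2) \<gamma>(2), of "L * (\<mu> * L)"]) auto
  then have "fhd (range (f \<circ> \<eta>)) (range (f \<circ> \<gamma>))" by (simp only: image_comp)
  then show ?thesis using fhd_trans[OF cl(3,4,1)] \<gamma>(3) by blast
qed

lemma image_ray_close:
  assumes \<eta>: "based_ray \<eta>" and fixed: "fhd (range (f \<circ> \<eta>)) (range \<eta>)" and y: "y \<in> carrier G"
  obtains s s' where "s \<ge> T" "s' \<ge> T" "gp (f y) (f (\<eta> s)) (\<eta> s') \<ge> A"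
proof -
  obtain m where m: "\<And>a. a \<in> range (f \<circ> \<eta>) \<Longrightarrow> \<exists>b\<in>range \<eta>. wd a b \<le> m"
    using fixed unfolding finite_Hausdorff_dist_def by blast
  have close: "\<exists>s'. d (f (\<eta> s)) (\<eta> s') \<le> L * m" for s
  proof -
    obtain s' where s': "wd (f (\<eta> s)) (\<eta> s') \<le> m" using m[of "f (\<eta> s)"] by auto
    have "d (f (\<eta> s)) (\<eta> s') \<le> L * wd (f (\<eta> s)) (\<eta> s')"
      using comparable(1) f_closed ray_closed \<eta> by blast
    also have "\<dots> \<le> L * m" using s' L_ge_1 by (intro mult_left_mono) auto
    finally show ?thesis by blast
  qed
  \<comment> \<open>The first entry forces \<open>s'\<close> beyond \<open>T\<close>, because a
    point near \<open>f (\<eta> s)\<close> is then too far from \<open>\<one>\<close> to be an early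
    point of the ray; the second makes the product at \<open>f y\<close> at least
    \<open>A\<close>.\<close>
  define Z where "Z = max (L * real T + L * m + 1) (A + L * m + d \<one> (f y))"
  obtain T' where T': "\<And>t. t \<ge> T' \<Longrightarrow> d \<one> (\<eta> t) \<ge> \<mu> * Z" using based_ray_unbounded[OF \<eta>] by blast
  define s where "s = max T T'"
  obtain s' where s': "d (f (\<eta> s)) (\<eta> s') \<le> L * m" using close by blast
  have "d \<one> (\<eta> s) \<le> \<mu> * d \<one> (f (\<eta> s))" using f_bilip[of \<one> "\<eta> s"] f_one ray_closed \<eta> by simp
  then have "\<mu> * Z \<le> \<mu> * d \<one> (f (\<eta> s))" using T'[of s] by (simp add: s_def)
  then have Z: "Z \<le> d \<one> (f (\<eta> s))" using mu_ge_1 by simp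
  have "s' \<ge> T"
  proof (rule ccontr)
    assume "\<not> T \<le> s'"
    then have "L * real s' \<le> L * real T" using L_ge_1 by simp
    moreover have "d \<one> (\<eta> s') \<le> L * real s'" using ray_dist_le[of \<eta> 0 s'] \<eta> by simp
    ultimately show False
      using Z s' dist_tri[of \<one> "f (\<eta> s)" "\<eta> s'"] dist_sym[of "\<eta> s'" "f (\<eta> s)"] dist_nonneg[of \<one> "f y"] unfolding Z_def by linarith
  qed
  moreover have "gp (f y) (f (\<eta> s)) (\<eta> s') \<ge> A"
    using Z s' gp_ge_dist[of "f y" "f (\<eta> s)" "\<eta> s'"] dist_tri[of \<one> "f (\<eta> s)" "f y"]
    unfolding Z_def by linarith
  ultimately show thesis using that[of s s'] by (simp add: s_def)
qed

text \<open>\<open>f y\<close> is again a quasi-center of the three fixed boundary points, so \<open>quasi_centers_close\<close> applies.\<close>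

lemma quasi_center_displacement:
  obtains E where "\<And>y \<eta> \<zeta> \<theta> T. y \<in> carrier G \<Longrightarrow> based_ray \<eta> \<Longrightarrow> based_ray \<zeta> \<Longrightarrow> based_ray \<theta> \<Longrightarrow>
    fhd (range (f \<circ> \<eta>)) (range \<eta>) \<Longrightarrow> fhd (range (f \<circ> \<zeta>)) (range \<zeta>) \<Longrightarrow> fhd (range (f \<circ> \<theta>)) (range \<theta>) \<Longrightarrow>
    (\<And>s t. s \<ge> T \<Longrightarrow> t \<ge> T \<Longrightarrow> gp y (\<eta> s) (\<zeta> t) \<le> B \<and> gp y (\<eta> s) (\<theta> t) \<le> B \<and> gp y (\<zeta> s) (\<theta> t) \<le> B) \<Longrightarrow>
    d y (f y) \<le> E"
proof -
  obtain K' where K': "\<And>a b c. a \<in> carrier G \<Longrightarrow> b \<in> carrier G \<Longrightarrow> c \<in> carrier G \<Longrightarrow> gp c a b \<le> B \<Longrightarrow>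
      gp (f c) (f a) (f b) \<le> K'"
    using gp_distortion[of \<mu> f B] mu_ge_1 f_closed f_bilip by metis
  show thesis
  proof (rule that[of "B + (K' + 2 * \<delta>) + 2 * \<delta>"])
    fix y \<eta> \<zeta> \<theta> T
    assume y: "y \<in> carrier G" and \<eta>: "based_ray \<eta>" "fhd (range (f \<circ> \<eta>)) (range \<eta>)"
      and \<zeta>: "based_ray \<zeta>" "fhd (range (f \<circ> \<zeta>)) (range \<zeta>)" and \<theta>: "based_ray \<theta>" "fhd (range (f \<circ> \<theta>)) (range \<theta>)"
      and gp: "\<And>s t. s \<ge> T \<Longrightarrow> t \<ge> T \<Longrightarrow> gp y (\<eta> s) (\<zeta> t) \<le> B \<and> gp y (\<eta> s) (\<theta> t) \<le> B \<and> gp y (\<zeta> s) (\<theta> t) \<le> B"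
    \<comment> \<open>One more than the bound aimed at, so that in \<open>gp_min3\<close> only the
      product of the two ray points can be the minimum.\<close>
    define A where "A = K' + 2 * \<delta> + 1"
    obtain a a' where a: "a \<ge> T" "a' \<ge> T" "gp (f y) (f (\<eta> a)) (\<eta> a') \<ge> A"
      using image_ray_close[OF \<eta> y] by blast
    obtain b b' where b: "b \<ge> T" "b' \<ge> T" "gp (f y) (f (\<zeta> b)) (\<zeta> b') \<ge> A"
      using image_ray_close[OF \<zeta> y] by blast
    obtain c c' where c: "c \<ge> T" "c' \<ge> T" "gp (f y) (f (\<theta> c)) (\<theta> c') \<ge> A"
      using image_ray_close[OF \<theta> y] by blast
    have *: "gp (f y) u' v' \<le> K' + 2 * \<delta>"
      if "u \<in> carrier G" "v \<in> carrier G" "gp y u v \<le> B" "gp (f y) (f u) u' \<ge> A" "gp (f y) (f v) v' \<ge> A" for u v u' v'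
      using K'[OF that(1,2) y that(3)] gp_min3[of "f y" "f u" u' v' "f v"] gp_sym[of "f y" v' "f v"] that(4,5)
      unfolding A_def by linarith
    have "gp (f y) (\<eta> a') (\<zeta> b') \<le> K' + 2 * \<delta>" "gp (f y) (\<eta> a') (\<theta> c') \<le> K' + 2 * \<delta>"
      "gp (f y) (\<zeta> b') (\<theta> c') \<le> K' + 2 * \<delta>"
      using *[OF _ _ _ a(3) b(3)] *[OF _ _ _ a(3) c(3)] *[OF _ _ _ b(3) c(3)] gp a b c ray_closed \<eta> \<zeta> \<theta> by simp_all
    then show "d y (f y) \<le> B + (K' + 2 * \<delta>) + 2 * \<delta>"
      using gp a b c by (intro quasi_centers_close[of y "\<eta> a'" "\<zeta> b'" _ "\<theta> c'"]) auto
  qed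
qed

text \<open>Two rays that fork at a far point of \<open>\<gamma>\<close> both follow
  \<open>\<gamma>\<close> up to there, but they cannot both follow it forever. If the products of
  the first with \<open>\<gamma>\<close> exceed the threshold, the first goes along with
  \<open>\<gamma>\<close> past the fork and the second must leave it.\<close>

lemma second_ray:
  assumes \<gamma>: "based_ray \<gamma>"
  obtains \<zeta> s t Q T r where "based_ray \<zeta>" "gp \<one> (\<zeta> s) (\<gamma> t) \<ge> N"
    "\<And>s t. s \<ge> T \<Longrightarrow> t \<ge> r \<Longrightarrow> gp \<one> (\<zeta> s) (\<gamma> t) \<le> Q"
proof -
  obtain m where m: "d \<one> (\<gamma> m) \<ge> N + D + K + 3 * \<delta>" using based_ray_unbounded[OF \<gamma>] by blast
  define y where "y = \<gamma> m"
  have y: "y \<in> carrier G" using \<gamma> ray_closed y_def by blast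
  obtain \<eta> \<zeta> T where \<eta>: "based_ray \<eta>" and \<zeta>: "based_ray \<zeta>"
    and gp: "\<And>s t. s \<ge> T \<Longrightarrow> t \<ge> T \<Longrightarrow> gp y (\<eta> s) (\<zeta> t) \<le> K + 2 * \<delta>"
    "\<And>t. t \<ge> T \<Longrightarrow> gp y \<one> (\<eta> t) \<le> K + 2 * \<delta>" "\<And>t. t \<ge> T \<Longrightarrow> gp y \<one> (\<zeta> t) \<le> K + 2 * \<delta>"
    using two_rays[OF y] by metis
  have near: "gp \<one> u (\<gamma> m) \<ge> N" if "gp y \<one> u \<le> K + 2 * \<delta>" for u
    using that m gp_add[of \<one> y u] gp_sym[of \<one> y u] D_nonneg delta_nonneg unfolding y_def by linarith
  define Q where "Q = K + 2 * \<delta> + d \<one> y"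
  have Q: "gp \<one> (\<eta> s) (\<zeta> t) \<le> Q" if "s \<ge> T" "t \<ge> T" for s t
    using gp(1)[OF that] gp_change_base[of \<one> "\<eta> s" "\<zeta> t" y] unfolding Q_def by linarith
  show thesis
  proof (cases "\<exists>s\<ge>T. \<exists>t. gp \<one> (\<eta> s) (\<gamma> t) > Q + 2 * \<delta> + D")
    case False
    then have "gp \<one> (\<eta> s) (\<gamma> t) \<le> Q + 2 * \<delta> + D" if "s \<ge> T" "t \<ge> 0" for s t using that by (meson not_le)
    then show thesis by (rule that[OF \<eta> near[OF gp(2)[OF order_refl]]])
  next
    case True
    then obtain s r where sr: "s \<ge> T" "gp \<one> (\<eta> s) (\<gamma> r) > Q + 2 * \<delta> + D" by blast
    have "gp \<one> (\<zeta> t) (\<gamma> t') \<le> Q + \<delta>" if "t \<ge> T" "t' \<ge> r" for t t'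
    proof -
      have "gp \<one> (\<gamma> r) (\<gamma> t') \<ge> d \<one> (\<gamma> r) - D" using ray_gp_ge[of \<gamma> r t'] \<gamma> that by simp
      then have "gp \<one> (\<eta> s) (\<gamma> t') > Q + \<delta>"
        using hyperbolic[of \<one> "\<eta> s" "\<gamma> r" "\<gamma> t'"] sr gp_le_dist(2)[of \<one> "\<eta> s" "\<gamma> r"] D_nonneg by linarith
      then show ?thesis
        using hyperbolic[of \<one> "\<eta> s" "\<gamma> t'" "\<zeta> t"] Q[OF sr(1) that(1)] gp_sym[of \<one> "\<gamma> t'" "\<zeta> t"] by linarith
    qed
    then show thesis by (rule that[OF \<zeta> near[OF gp(3)[OF order_refl]]])
  qed
qed

text \<open>The balls are centered at far points \<open>x\<close> of \<open>\<gamma>\<close>. Rays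
  forking at an element \<open>z\<close> of such a ball share with \<open>\<gamma>\<close> a long
  initial part, so their classes lie in \<open>U\<close>; together with \<open>\<zeta>\<close> they
  have \<open>z\<close> as a quasi-center. Neither \<open>B\<close> nor \<open>E\<close> depends on
  the radius.\<close>

lemma bounded_displacement_on_balls:
  assumes U: "openin (boundary_topology G S) U" "U \<noteq> {}"
    and fixed: "\<And>\<xi>. \<xi> \<in> U \<Longrightarrow> boundary_map G S f \<xi> = \<xi>"
  obtains E where "\<And>n::nat. \<exists>x\<in>carrier G. \<forall>y\<in>carrier G. d \<one> y \<le> real n \<longrightarrow> d (x \<otimes> y) (f (x \<otimes> y)) \<le> E"
proof -
  obtain \<xi> where \<xi>: "\<xi> \<in> U" using U(2) by blast
  moreover have "U \<subseteq> Gromov_boundary G S" using U(1) openin_boundary_topology by blast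
  ultimately obtain \<gamma>' where "ray \<gamma>'" "\<xi> = ray_class G S \<gamma>'" unfolding Gromov_boundary_def by blast
  then obtain \<gamma> where \<gamma>: "based_ray \<gamma>" "ray_class G S \<gamma> \<in> U"
    using based_representative \<xi> by metis
  obtain N where N: "\<And>\<eta> s t. based_ray \<eta> \<Longrightarrow> gp \<one> (\<eta> s) (\<gamma> t) \<ge> N \<Longrightarrow> ray_class G S \<eta> \<in> U"
    using nearby_rays_open[OF U(1) \<gamma>] by metis
  have fixes_ray: "fhd (range (f \<circ> \<eta>)) (range \<eta>)" if "based_ray \<eta>" "gp \<one> (\<eta> s) (\<gamma> t) \<ge> N" for \<eta> s t
    using fixed_point_fhd fixed N that by blast
  obtain \<zeta> s0 t0 Q T r where \<zeta>: "based_ray \<zeta>" "gp \<one> (\<zeta> s0) (\<gamma> t0) \<ge> N"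
    and Q: "\<And>s t. s \<ge> T \<Longrightarrow> t \<ge> r \<Longrightarrow> gp \<one> (\<zeta> s) (\<gamma> t) \<le> Q"
    using second_ray[OF \<gamma>(1)] by metis
  define B where "B = K + 3 * \<delta>"
  obtain E where E: "\<And>y \<eta> \<zeta> \<theta> T. y \<in> carrier G \<Longrightarrow> based_ray \<eta> \<Longrightarrow> based_ray \<zeta> \<Longrightarrow> based_ray \<theta> \<Longrightarrow>
    fhd (range (f \<circ> \<eta>)) (range \<eta>) \<Longrightarrow> fhd (range (f \<circ> \<zeta>)) (range \<zeta>) \<Longrightarrow> fhd (range (f \<circ> \<theta>)) (range \<theta>) \<Longrightarrow>
    (\<And>s t. s \<ge> T \<Longrightarrow> t \<ge> T \<Longrightarrow> gp y (\<eta> s) (\<zeta> t) \<le> B \<and> gp y (\<eta> s) (\<theta> t) \<le> B \<and> gp y (\<zeta> s) (\<theta> t) \<le> B) \<Longrightarrow>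
    d y (f y) \<le> E"
    using quasi_center_displacement[of B] by metis
  have "\<exists>x\<in>carrier G. \<forall>y\<in>carrier G. d \<one> y \<le> real n \<longrightarrow> d (x \<otimes> y) (f (x \<otimes> y)) \<le> E" for n
  proof -
    \<comment> \<open>The first entry makes every ray through the ball follow
      \<open>\<gamma>\<close> long enough for its class to be in \<open>U\<close>; the second makes
      the ball lie far beyond the place where \<open>\<zeta>\<close> leaves
      \<open>\<gamma>\<close>.\<close>
    define Z where "Z = max (N + real n + K + 4 * \<delta> + D) (Q + 4 * \<delta> + real n + K + 1)"
    obtain m' where m': "\<And>t. t \<ge> m' \<Longrightarrow> d \<one> (\<gamma> t) \<ge> Z" using based_ray_unbounded[OF \<gamma>(1)] by blast
    define m where "m = max m' r"
    define x where "x = \<gamma> m"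
    have x: "x \<in> carrier G" "d \<one> x \<ge> Z" using m' \<gamma>(1) ray_closed by (auto simp: x_def m_def)
    have Zn: "Z \<ge> N + real n + K + 4 * \<delta> + D" "Z \<ge> Q + 4 * \<delta> + real n + K + 1" by (simp_all add: Z_def)
    have "d (x \<otimes> y) (f (x \<otimes> y)) \<le> E" if y: "y \<in> carrier G" "d \<one> y \<le> real n" for y
    proof -
      define z where "z = x \<otimes> y"
      have z: "z \<in> carrier G" "d x z \<le> real n" using x y dist_right by (auto simp: z_def)
      have xz: "gp \<one> x z \<ge> d \<one> x - real n" using gp_ge_dist[of \<one> x z] z by linarith
      have dz: "d \<one> z \<ge> d \<one> x - real n" using dist_tri[of \<one> x z] z dist_sym[of x z] by linarith
      obtain \<eta> \<theta> T' where \<eta>: "based_ray \<eta>" and \<theta>: "based_ray \<theta>"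
        and gp: "\<And>s t. s \<ge> T' \<Longrightarrow> t \<ge> T' \<Longrightarrow> gp z (\<eta> s) (\<theta> t) \<le> K + 2 * \<delta>"
        "\<And>t. t \<ge> T' \<Longrightarrow> gp z \<one> (\<eta> t) \<le> K + 2 * \<delta>" "\<And>t. t \<ge> T' \<Longrightarrow> gp z \<one> (\<theta> t) \<le> K + 2 * \<delta>"
        using two_rays[OF z(1)] by metis
      have near: "gp \<one> u x \<ge> N" if "gp z \<one> u \<le> K + 2 * \<delta>" for u
        using that gp_add[of \<one> z u] gp_sym[of \<one> z u] hyperbolic[of \<one> u z x] xz gp_sym[of \<one> x z]
          dz x(2) Zn(1) D_nonneg K_nonneg delta_nonneg by linarith
      have fix\<eta>: "fhd (range (f \<circ> \<eta>)) (range \<eta>)" and fix\<theta>: "fhd (range (f \<circ> \<theta>)) (range \<theta>)"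
        and fix\<zeta>: "fhd (range (f \<circ> \<zeta>)) (range \<zeta>)"
        using fixes_ray[OF \<eta>, of T' m] fixes_ray[OF \<theta>, of T' m] fixes_ray[OF \<zeta>] near gp(2)[of T'] gp(3)[of T']
        by (auto simp: x_def)
      \<comment> \<open>Seen from \<open>z\<close>, late points of \<open>\<zeta>\<close> lie in the
        direction of \<open>\<one>\<close> while \<open>u\<close> does not; this one use of
        hyperbolicity accounts for the third \<delta> in \<open>B\<close>.\<close>
      have third: "gp z (\<zeta> s) u \<le> B" if s: "s \<ge> T" and u: "gp z \<one> u \<le> K + 2 * \<delta>" for s u
      proof -
        have "gp \<one> (\<zeta> s) x \<le> Q" using Q[OF s] by (simp add: x_def m_def)
        then have "gp \<one> (\<zeta> s) z \<le> Q + \<delta>"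
          using hyperbolic[of \<one> "\<zeta> s" z x] xz gp_sym[of \<one> x z] x(2) Zn(2) K_nonneg delta_nonneg by linarith
        then have "gp z \<one> (\<zeta> s) > K + 3 * \<delta>"
          using gp_add[of \<one> z "\<zeta> s"] gp_sym[of \<one> z "\<zeta> s"] dz x(2) Zn(2) K_nonneg delta_nonneg by linarith
        then show ?thesis
          using hyperbolic[of z \<one> "\<zeta> s" u] u unfolding B_def by linarith
      qed
      have "d z (f z) \<le> E"
      proof (rule E[OF z(1) \<zeta>(1) \<eta> \<theta> fix\<zeta> fix\<eta> fix\<theta>, of "max T T'"])
        fix s t assume "s \<ge> max T T'" "t \<ge> max T T'"
        then have st: "s \<ge> T" "s \<ge> T'" "t \<ge> T'" by simp_all
        have "gp z (\<eta> s) (\<theta> t) \<le> B" using gp(1)[OF st(2,3)] delta_nonneg B_def by linarith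
        then show "gp z (\<zeta> s) (\<eta> t) \<le> B \<and> gp z (\<zeta> s) (\<theta> t) \<le> B \<and> gp z (\<eta> s) (\<theta> t) \<le> B"
          using third[OF st(1) gp(2)[OF st(3)]] third[OF st(1) gp(3)[OF st(3)]] by blast
      qed
      then show ?thesis by (simp add: z_def)
    qed
    then show ?thesis using x(1) by blast
  qed
  then show thesis by (rule that)
qed

end

section \<open>Torsion-free groups and the conclusion\<close>

lemma torsion_free_trivial_radical:
  assumes "group H" "torsion_free_group H"
  shows "trivial_finite_radical H"
  unfolding trivial_finite_radical_def
proof (intro allI impI)
  fix N assume N: "N \<lhd> H \<and> finite N"
  interpret group H by (rule assms(1))
  have sub: "subgroup N H" using N by (simp add: normal_imp_subgroup)
  have "x = \<one>\<^bsub>H\<^esub>" if x: "x \<in> N" for x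
  proof -
    have xH: "x \<in> carrier H" using x sub subgroup.subset by blast
    have "x [^]\<^bsub>H\<^esub> n \<in> N" for n :: nat
      by (induction n) (simp_all add: x sub subgroup.one_closed subgroup.m_closed)
    then have "range (\<lambda>n::nat. x [^]\<^bsub>H\<^esub> n) \<subseteq> N" by blast
    then have "\<not> inj (\<lambda>n::nat. x [^]\<^bsub>H\<^esub> n)"
      using N finite_imageD finite_subset infinite_UNIV_nat by metis
    then obtain i j :: nat where "i < j" "x [^]\<^bsub>H\<^esub> j = x [^]\<^bsub>H\<^esub> i"
      unfolding inj_def by (metis linorder_neqE_nat)
    then have "x [^]\<^bsub>H\<^esub> (j - i) = \<one>\<^bsub>H\<^esub>" "j - i > 0" using pow_eq_div2[OF xH] by simp_all
    then show ?thesis using assms(2) xH unfolding torsion_free_group_def by blast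
  qed
  then show "N = {\<one>\<^bsub>H\<^esub>}" using subgroup.one_closed[OF sub] by blast
qed

text \<open>The distance \<open>d\<close> comes from a generating set \<open>S0\<close> that
  witnesses hyperbolicity, the boundary from the given \<open>S\<close>. The identity homomorphism,
  Lipschitz in both directions, yields the comparison constant \<open>L\<close>.\<close>

lemma topologically_free_boundary:
  assumes H: "group H" "hyperbolic_group H" "non_elementary H" "finite_generating_set H S"
    and rad: "trivial_finite_radical H"
  shows "topologically_free (AutoGroup H) (boundary_topology H S) (boundary_map H S)"
proof -
  obtain d \<delta> S0 where d: "hyperbolic_metric_group H d \<delta>" "finite_generating_set H S0"
    "\<And>x y. x \<in> carrier H \<Longrightarrow> y \<in> carrier H \<Longrightarrow> d x y = word_dist H S0 x y"
    using hyperbolic_group_metric[OF H(1,2)] by metis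
  interpret hyperbolic_metric_group H d \<delta> by (rule d(1))
  interpret generated_group H S by standard (rule H(4))
  interpret S0: generated_group H S0 by standard (rule d(2))
  have id: "(\<lambda>x. x) \<in> hom H H" by (simp add: hom_def)
  obtain L1 where L1: "L1 \<ge> 1" "\<And>x y. x \<in> carrier H \<Longrightarrow> y \<in> carrier H \<Longrightarrow> S0.wd x y \<le> L1 * wd x y"
    using hom_lipschitz[OF id d(2)] by metis
  obtain L2 where L2: "L2 \<ge> 1" "\<And>x y. x \<in> carrier H \<Longrightarrow> y \<in> carrier H \<Longrightarrow> wd x y \<le> L2 * S0.wd x y"
    using S0.hom_lipschitz[OF id H(4)] by metis
  define L where "L = max L1 L2"
  have L: "L \<ge> 1" using L1 by (simp add: L_def)
  have comparable: "d x y \<le> L * wd x y \<and> wd x y \<le> L * d x y" if "x \<in> carrier H" "y \<in> carrier H" for x y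
  proof -
    have "L1 * wd x y \<le> L * wd x y" "L2 * d x y \<le> L * d x y"
      by (auto intro!: mult_right_mono simp: L_def wd_eq)
    then show ?thesis using L1(2)[OF that] L2(2)[OF that] d(3)[OF that] by simp
  qed
  obtain D where D: "D \<ge> 0" "\<And>c n k. bilip L c n \<Longrightarrow> k \<le> n \<Longrightarrow> gp (c k) (c 0) (c n) \<le> D"
    using Morse_gp[OF L] by metis
  obtain C where C: "\<And>c n z B. bilip L c n \<Longrightarrow> gp z (c 0) (c n) \<le> B \<Longrightarrow> \<exists>i\<le>n. d z (c i) \<le> 2 * B + C"
    using near_bilip[OF L] by metis
  obtain K where K: "K \<ge> 0" "\<And>R. \<exists>p\<in>carrier H. \<exists>q\<in>carrier H. \<exists>r\<in>carrier H.
      R \<le> d \<one>\<^bsub>H\<^esub> p \<and> R \<le> d \<one>\<^bsub>H\<^esub> q \<and> R \<le> d \<one>\<^bsub>H\<^esub> r \<and>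
      gp \<one>\<^bsub>H\<^esub> p q \<le> K \<and> gp \<one>\<^bsub>H\<^esub> p r \<le> K \<and> gp \<one>\<^bsub>H\<^esub> q r \<le> K"
    using three_directions[OF H(3)] by metis
  have setting: "boundary_setting H d \<delta> S L D C K"
    by unfold_locales (use L D C K comparable in auto)
  show ?thesis
    unfolding topologically_free_def
  proof (intro ballI)
    fix \<phi> assume \<phi>: "\<phi> \<in> carrier (AutoGroup H) - {\<one>\<^bsub>AutoGroup H\<^esub>}"
    define U where "U = boundary_topology H S interior_of
      {\<xi> \<in> topspace (boundary_topology H S). boundary_map H S \<phi> \<xi> = \<xi>}"
    have hom: "\<phi> \<in> hom H H" and Bij: "\<phi> \<in> Bij (carrier H)" and ne: "\<phi> \<noteq> (\<lambda>x\<in>carrier H. x)"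
      using \<phi> by (auto simp: AutoGroup_def BijGroup_def auto_def)
    define \<psi> where "\<psi> = restrict (inv_into (carrier H) \<phi>) (carrier H)"
    \<comment> \<open>The inverse is again a homomorphism, hence Lipschitz; this gives the lower
      half of the bilipschitz estimate for \<open>\<phi>\<close>.\<close>
    have \<psi>: "\<psi> \<in> hom H H" unfolding \<psi>_def by (rule restrict_inv_into_hom[OF hom Bij])
    have closed: "\<phi> x \<in> carrier H" if "x \<in> carrier H" for x using hom that by (rule hom_in_carrier)
    have inj: "inj_on \<phi> (carrier H)" using Bij by (simp add: Bij_def bij_betw_def)
    have \<psi>\<phi>: "\<psi> (\<phi> x) = x" if "x \<in> carrier H" for x
      using inj that closed by (simp add: \<psi>_def)
    obtain \<mu>1 where \<mu>1: "\<mu>1 \<ge> 1" "\<And>x y. x \<in> carrier H \<Longrightarrow> y \<in> carrier H \<Longrightarrow> S0.wd (\<phi> x) (\<phi> y) \<le> \<mu>1 * S0.wd x y"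
      using S0.hom_lipschitz[OF hom d(2)] by metis
    obtain \<mu>2 where \<mu>2: "\<mu>2 \<ge> 1" "\<And>x y. x \<in> carrier H \<Longrightarrow> y \<in> carrier H \<Longrightarrow> S0.wd (\<psi> x) (\<psi> y) \<le> \<mu>2 * S0.wd x y"
      using S0.hom_lipschitz[OF \<psi> d(2)] by metis
    define \<mu> where "\<mu> = max \<mu>1 \<mu>2"
    have bilip: "d (\<phi> x) (\<phi> y) \<le> \<mu> * d x y \<and> d x y \<le> \<mu> * d (\<phi> x) (\<phi> y)"
      if xy: "x \<in> carrier H" "y \<in> carrier H" for x y
    proof -
      have "\<mu>1 * d x y \<le> \<mu> * d x y" "\<mu>2 * d (\<phi> x) (\<phi> y) \<le> \<mu> * d (\<phi> x) (\<phi> y)"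
        by (auto intro!: mult_right_mono simp: \<mu>_def)
      moreover have "S0.wd x y \<le> \<mu>2 * S0.wd (\<phi> x) (\<phi> y)"
        using \<mu>2(2)[OF closed[OF xy(1)] closed[OF xy(2)]] \<psi>\<phi> xy by simp
      ultimately show ?thesis using \<mu>1(2)[OF xy] d(3) xy closed by simp
    qed
    interpret boundary_setting H d \<delta> S L D C K by (rule setting)
    interpret boundary_action H d \<delta> S L D C K \<phi> \<mu>
    proof
      show "\<phi> \<one>\<^bsub>H\<^esub> = \<one>\<^bsub>H\<^esub>" using hom_one[OF hom H(1) H(1)] .
      show "\<mu> \<ge> 1" using \<mu>1(1) by (simp add: \<mu>_def)
    qed (use closed bilip in auto)
    show "boundary_topology H S interior_of
      {\<xi> \<in> topspace (boundary_topology H S). boundary_map H S \<phi> \<xi> = \<xi>} = {}"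
      unfolding U_def[symmetric]
    proof (rule ccontr)
      assume "U \<noteq> {}"
      moreover have "openin (boundary_topology H S) U" unfolding U_def by (rule openin_interior_of)
      moreover have "boundary_map H S \<phi> \<xi> = \<xi>" if "\<xi> \<in> U" for \<xi>
        using that interior_of_subset unfolding U_def by fastforce
      ultimately obtain E where E: "\<And>n::nat. \<exists>x\<in>carrier H. \<forall>y\<in>carrier H. d \<one>\<^bsub>H\<^esub> y \<le> real n \<longrightarrow>
          d (x \<otimes>\<^bsub>H\<^esub> y) (\<phi> (x \<otimes>\<^bsub>H\<^esub> y)) \<le> E"
        using bounded_displacement_on_balls[of U] by metis
      \<comment> \<open>The unit of \<open>AutoGroup H\<close> is the identity restricted to the
        carrier. Elements of \<open>Bij\<close> are extensional, so the two functions agree off the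
        carrier too.\<close>
      have "\<phi> x = (\<lambda>x\<in>carrier H. x) x" for x
        using automorphism_trivial[OF H(3) rad hom E] Bij
        by (cases "x \<in> carrier H") (auto simp: Bij_def extensional_def)
      then show False using ne by blast
    qed
  qed
qed

theorem corollary1p2:
  fixes H :: "('a, 'b) monoid_scheme" and S :: "'a set"
  assumes "group H"
    and "hyperbolic_group H"
    and "non_elementary H"
    and "finite_generating_set H S"
  shows "(trivial_finite_radical H \<longrightarrow>
            topologically_free (AutoGroup H) (boundary_topology H S) (boundary_map H S)) \<and>
         (torsion_free_group H \<longrightarrow> trivial_finite_radical H)"
  using topologically_free_boundary[OF assms] torsion_free_trivial_radical[OF assms(1)] by blast

end
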